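(* Suppose that Assumptions 1, 2 and 3 (written out in the context) hold, let $\tau>0$ be the sampling period and let $\bar z$ be a branch of $S$. Let $\gamma_x^u\in\mathcal L$ and $\epsilon_x$ be as in the plant estimate (P) of the context, and let $\gamma_u^x\in\mathcal{KL}$ and $\bar\varepsilon_2$ be as in the algorithm estimate (A) of the context. Put $\tilde\epsilon=\min\{0.25\,\epsilon_x,\bar\varepsilon_2\}$. If the small-gain condition $$\gamma_x^u(\tau)\,\gamma_u^x(s,\tau)<s\qquad\forall s\in(0,\tilde\epsilon]$$ is satisfied, then the discrete-time closed-loop system (in error coordinates) $$x^{k+1}=\psi^k(x^k,u^k,\tilde w^k),\quad y^k=g(x^k,w^k),\quad z^{k+1}=T(z^k,y^{k+1}),\quad u^k=q(z^k),$$ $$\delta x^k=x^k-p(u^k,w^k),\qquad e^k=z^k-\bar z(w^k),$$ is locally input-to-state stable (LISS) about the origin with respect to the disturbance sequence $d$, i.e., there exist $\epsilon>0$, $\beta\in\mathcal{KL}$ and $\gamma\in\mathcal K$ such that $|(\delta x^k,e^k)|\le\beta(|(\delta x^0,e^0)|,k)+\gamma(\|d\|)$ for all $k\ge0$, provided $|(\delta x^0,e^0)|\le\epsilon$ and $\|d\|\le\epsilon$.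
   Context: Notation. $|\cdot|$ is the Euclidean norm; for a signal $x:\mathbb R_{\ge0}\to\mathbb R^n$, $\|x\|=\operatorname{ess\,sup}_{t\ge0}|x(t)|$, and for a sequence $\|y\|=\sup_{k\ge0}|y_k|$. A function $\gamma:\mathbb R_{\ge0}\to\mathbb R_{\ge0}$ is of class $\mathcal K$ if it is continuous, strictly increasing and $\gamma(0)=0$; of class $\mathcal K_\infty$ if moreover unbounded; $\sigma:\mathbb R_{\ge0}\to\mathbb R_{\ge0}$ is of class $\mathcal L$ if continuous, strictly decreasing and $\sigma(s)\to0$ as $s\to\infty$; $\beta:\mathbb R_{\ge0}^2\to\mathbb R_{\ge0}$ is of class $\mathcal{KL}$ if $\beta(\cdot,s)\in\mathcal K$ for each fixed $s$ and $\beta(r,\cdot)\in\mathcal L$ for each fixed $r$. Plant. $\dot x=f(x,u,w)$, $y=g(x,w)$ with $x(t)\in\mathbb R^{n_x}$, $y(t)\in\mathbb R^{n_y}$, $u(t)\in\mathcal U\subset\mathbb R^{n_u}$, $w(t)\in\mathcal W\subset\mathbb R^{n_w}$. There is a steady-state map $p:\mathcal U\times\mathcal W\to\mathbb R^{n_x}$ with $f(p(u,w),u,w)=0$ for all $(u,w)\in\mathcal U\times\mathcal W$; set $h(u,w)=g(p(u,w),w)$. Generalized equation. Given single-valued $G:\mathbb R^{n_z}\times\mathbb R^{n_y}\to\mathbb R^{n_z}$, set-valued $\mathcal A:\mathbb R^{n_z}\rightrightarrows\mathbb R^{n_z}$ and $q:\mathbb R^{n_z}\to\mathcal U$, let $\mathbb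 G(z,w)=G(z,h(q(z),w))$ and $S(w)=\{z\in\mathbb R^{n_z}: 0\in\mathbb G(z,w)+\mathcal A(z)\}$ for $w\in\mathcal W$. Algorithm. $T:\mathbb R^{n_z}\times\mathbb R^{n_y}\to\mathbb R^{n_z}$ and $\mathbb T(z,w)=T(z,h(q(z),w))$. Assumption 1. (i) $f$ is locally Lipschitz; (ii) $g$ is globally $L_g$-Lipschitz; (iii) $w$ is continuously differentiable with $\|\dot w\|<\infty$; (iv) $\mathcal W$ and $\mathcal U$ are compact and convex; (v) there exist $\epsilon_x,\epsilon_w,\alpha_3,\alpha_4,\alpha_5>0$, a continuously differentiable function $V$ and $\sigma_1\in\mathcal K$ such that, for any constant $u\in\mathcal U$, $\alpha_3|x-p(u,w)|^2\le V(x,u,w)\le\alpha_4|x-p(u,w)|^2$ and, along plant trajectories, $\dot V(x(t),u,w(t))\le-\alpha_5V(x(t),u,w(t))+\sigma_1(|\dot w(t)|)$, whenever $V(x(t),u,w(t))\le\epsilon_x$ and $|\dot w(t)|\le\epsilon_w$. Assumption 2. (i) $q$ is globally $L_q$-Lipschitz; (ii) $G$ is continuously differentiable; (iii) for every $w\in\mathcal W$ and $z\in S(w)$, the mapping $\Psi=\mathbb G(\cdot,w)+\mathcal A(\cdot)$ is strongly regular at $(z,0)$, where $\Psi$ is strongly regular at $(x,y)$ if $y\in\Psi(x)$ and there are neighborhoods $X$ of $x$ and $Y$ of $y$ such that $y'\mapsto\Psi^{-1}(y')\cap X$ is a (single-valued) Lipschitz continuous function on $Y$. Assumption 3. (i)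 For all $w\in\mathcal W$: $z=\mathbb T(z,w)$ iff $z\in S(w)$. (ii) There exist a continuous $W:\mathbb R^{n_z}\times\mathcal W\to\mathbb R$, a constant $\epsilon_z>0$, $\alpha_1,\alpha_2\in\mathcal K_\infty$ and $\alpha\in\mathcal K$ such that for all $w\in\mathcal W$, $\bar z\in S(w)$ and $z$ with $|z-\bar z|\le\epsilon_z$: $\alpha_1(|z-\bar z|)\le W(z,w)\le\alpha_2(|z-\bar z|)$ and $W(\mathbb T(z,w),w)\le W(z,w)-\alpha(|z-\bar z|)$. (iii) There is $L_T>0$ such that for every fixed $z$, $|T(z,s)-T(z,s')|\le L_T|s-s'|$ for all $s,s'\in\mathbb R^{n_y}$. Branches. Under Assumption 2 it is known that, for any disturbance signal $w$, the set of solution trajectories $\{z(\cdot): z(t)\in S(w(t))\ \forall t\ge0\}$ consists of finitely many Lipschitz continuous isolated trajectories, called branches. A branch is written as a Lipschitz function $w\mapsto\bar z(w)$ with $\bar z(w)\in S(w)$. Sampling. $t^k=k\tau$, $w^k=w(t^k)$, $\tilde w^k$ is the restriction of $w$ to $[t^k,t^{k+1})$, $\psi^k(\xi^k,v,\tilde w^k)$ is the value at $t=t^{k+1}$ of the solution of $\dot\xi(t)=f(\xi(t),v,w(t))$, $\xi(t^k)=\xi^k$, and $d^k=\operatorname{ess\,sup}_{t\in[t^k,t^{k+1}]}|\dot w(t)|$. Put $V^k=V(x^k,u^k,w^k)$, $W^k=W(z^k,w^k)$, $\Delta u^k=u^{k+1}-u^k$, $\|V\|=\sup_{k\ge0}V^k$.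 (P) Plant estimate. Under Assumptions 1–3 there exist $\beta_x\in\mathcal{KL}$, $\gamma_x^u\in\mathcal L$, $\gamma_x^d\in\mathcal{KL}$, $\pi_1>0$, $\pi_2\in\mathcal K$ such that for $x^{k+1}=\psi^k(x^k,u^k,\tilde w^k)$ one has $V^k\le\beta_x(V^0,k\tau)+\gamma_x^u(\tau)\|\Delta u\|+\gamma_x^d(\|d\|,\tau)$, provided $V^0\le0.25\epsilon_x$, $\|\Delta u\|\le\pi_1\epsilon_x$, $\pi_2(\|d\|)\le\epsilon_x$ and $\|d\|\le\epsilon_w$. (A) Algorithm estimate. Under Assumptions 1–3 there exist $\bar\varepsilon_1,\bar\varepsilon_2,\bar\varepsilon_3>0$, $\beta_z,\beta_u\in\mathcal{KL}$, $\gamma_z^x,\gamma_u^x\in\mathcal{KL}$, $\gamma_z^d,\gamma_u^d\in\mathcal K$ such that the recursion $z^{k+1}=T(z^k,g(\psi^k(x^k,u^k,\tilde w^k),w^{k+1}))$, $u^k=q(z^k)$, driven by $x^k=p(u^k,w^k)+\delta x^k$, satisfies, whenever $W^0\le\bar\varepsilon_1$, $\|V\|\le\bar\varepsilon_2$, $\|d\|\le\bar\varepsilon_3$, $W^k\le\beta_z(W^0,k)+\gamma_z^x(\|V\|,\tau)+\gamma_z^d(\|d\|)$ and $|\Delta u^k|\le\beta_u(W^0,k)+\gamma_u^x(\|V\|,\tau)+\gamma_u^d(\|d\|)$.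
   Formalization: Added hypothesis: for each w in W, the map z ↦ 𝕋(z,w) is continuous at the branch value z̄(w). Without it the claim fails (T may jump to another branch from points arbitrarily near z̄), and LISS implies it. *)

theory Defs
  imports "HOL-Analysis.Analysis" "HOL-Probability.Essential_Supremum"
begin

section \<open>Comparison functions\<close>

text \<open>Functions on the nonnegative reals are represented by functions on \<^typ>\<open>real\<close> of which
  only the values on \<open>{0..}\<close> matter. Nonnegativity on \<open>{0..}\<close> follows from the definitions.\<close>

definition class_K :: "(real \<Rightarrow> real) \<Rightarrow> bool" where
  "class_K \<gamma> \<longleftrightarrow> continuous_on {0..} \<gamma> \<and> strict_mono_on {0..} \<gamma> \<and> \<gamma> 0 = 0"

definition class_K_inf :: "(real \<Rightarrow> real) \<Rightarrow> bool" where
  "class_K_inf \<gamma> \<longleftrightarrow> class_K \<gamma> \<and> \<not> bdd_above (\<gamma> ` {0..})"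

definition class_L :: "(real \<Rightarrow> real) \<Rightarrow> bool" where
  "class_L \<sigma> \<longleftrightarrow> continuous_on {0..} \<sigma> \<and> (\<forall>s\<ge>0. \<forall>t>s. \<sigma> t < \<sigma> s) \<and> (\<sigma> \<longlongrightarrow> 0) at_top"

text \<open>The class L condition is imposed for \<open>r > 0\<close> only: \<open>\<beta> 0 s = 0\<close> for all \<open>s\<close>, so \<open>\<beta> 0\<close>
  is never strictly decreasing.\<close>

definition class_KL :: "(real \<Rightarrow> real \<Rightarrow> real) \<Rightarrow> bool" where
  "class_KL \<beta> \<longleftrightarrow> (\<forall>s\<ge>0. class_K (\<lambda>r. \<beta> r s)) \<and> (\<forall>r>0. class_L (\<beta> r))"

section \<open>Regularity notions\<close>

definition locally_lipschitz_on :: "'a::metric_space set \<Rightarrow> ('a \<Rightarrow> 'b::metric_space) \<Rightarrow> bool" where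
  "locally_lipschitz_on D F \<longleftrightarrow> (\<forall>a\<in>D. \<exists>r>0. \<exists>L. L-lipschitz_on (ball a r \<inter> D) F)"

definition C1_on :: "'a::real_normed_vector set \<Rightarrow> ('a \<Rightarrow> 'b::real_normed_vector) \<Rightarrow> bool" where
  "C1_on D F \<longleftrightarrow> (\<exists>F'. (\<forall>a\<in>D. (F has_derivative blinfun_apply (F' a)) (at a within D))
      \<and> continuous_on D F')"

definition strongly_regular_at ::
    "('a::metric_space \<Rightarrow> 'b::metric_space set) \<Rightarrow> 'a \<Rightarrow> 'b \<Rightarrow> bool" where
  "strongly_regular_at \<Psi> a b \<longleftrightarrow> b \<in> \<Psi> a \<and>
     (\<exists>X Y s L. open X \<and> a \<in> X \<and> open Y \<and> b \<in> Y \<and> L-lipschitz_on Y s \<and>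
        (\<forall>b'\<in>Y. {a'. b' \<in> \<Psi> a'} \<inter> X = {s b'}))"

section \<open>Signals and sampling\<close>

definition signal_deriv :: "(real \<Rightarrow> 'w::real_normed_vector) \<Rightarrow> real \<Rightarrow> 'w" where
  "signal_deriv w t = vector_derivative w (at t within {0..})"

definition disturbance :: "'w::euclidean_space set \<Rightarrow> (real \<Rightarrow> 'w) \<Rightarrow> bool" where
  "disturbance Ws w \<longleftrightarrow> (\<forall>t\<ge>0. w t \<in> Ws \<and> w differentiable (at t within {0..}))
     \<and> continuous_on {0..} (signal_deriv w)
     \<and> esssup (restrict_space lborel {0..}) (\<lambda>t. ereal (norm (signal_deriv w t))) < \<infinity>"

definition sample :: "real \<Rightarrow> (real \<Rightarrow> 'w) \<Rightarrow> nat \<Rightarrow> 'w" where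
  "sample \<tau> w k = w (real k * \<tau>)"

definition dist_seq :: "real \<Rightarrow> (real \<Rightarrow> 'w::euclidean_space) \<Rightarrow> nat \<Rightarrow> real" where
  "dist_seq \<tau> w k = real_of_ereal (esssup (restrict_space lborel {real k * \<tau>..real (Suc k) * \<tau>})
     (\<lambda>t. ereal (norm (signal_deriv w t))))"

text \<open>The supremum norm; meaningful only for bounded sequences.\<close>

definition seq_norm :: "(nat \<Rightarrow> 'a::real_normed_vector) \<Rightarrow> real" where
  "seq_norm y = (SUP k. norm (y k))"

section \<open>Plant\<close>

definition plant_solution ::
    "('x::euclidean_space \<Rightarrow> 'u \<Rightarrow> 'w \<Rightarrow> 'x) \<Rightarrow> 'u \<Rightarrow> (real \<Rightarrow> 'w) \<Rightarrow> real \<Rightarrow> real \<Rightarrow> (real \<Rightarrow> 'x) \<Rightarrow> bool" where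
  "plant_solution f v w a b \<xi> \<longleftrightarrow>
     (\<forall>t\<in>{a..b}. (\<xi> has_vector_derivative f (\<xi> t) v (w t)) (at t within {a..b}))"

definition plant_step ::
    "('x::euclidean_space \<Rightarrow> 'u \<Rightarrow> 'w \<Rightarrow> 'x) \<Rightarrow> real \<Rightarrow> (real \<Rightarrow> 'w) \<Rightarrow> nat \<Rightarrow> 'x \<Rightarrow> 'u \<Rightarrow> 'x" where
  "plant_step f \<tau> w k x v = (THE x'. \<exists>\<xi>. plant_solution f v w (real k * \<tau>) (real (Suc k) * \<tau>) \<xi>
      \<and> \<xi> (real k * \<tau>) = x \<and> \<xi> (real (Suc k) * \<tau>) = x')"

definition steady_state_map ::
    "('x::euclidean_space \<Rightarrow> 'u \<Rightarrow> 'w \<Rightarrow> 'x) \<Rightarrow> 'u set \<Rightarrow> 'w set \<Rightarrow> ('u \<Rightarrow> 'w \<Rightarrow> 'x) \<Rightarrow> bool" where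
  "steady_state_map f Us Ws p \<longleftrightarrow> (\<forall>v\<in>Us. \<forall>\<omega>\<in>Ws. f (p v \<omega>) v \<omega> = 0)"

definition plant_lyapunov ::
    "('x::euclidean_space \<Rightarrow> 'u::euclidean_space \<Rightarrow> 'w::euclidean_space \<Rightarrow> 'x) \<Rightarrow> ('u \<Rightarrow> 'w \<Rightarrow> 'x)
     \<Rightarrow> 'u set \<Rightarrow> 'w set \<Rightarrow> ('x \<Rightarrow> 'u \<Rightarrow> 'w \<Rightarrow> real) \<Rightarrow> real \<Rightarrow> real \<Rightarrow> bool" where
  "plant_lyapunov f p Us Ws V \<epsilon>x \<epsilon>w \<longleftrightarrow> \<epsilon>x > 0 \<and> \<epsilon>w > 0 \<and>
     C1_on (UNIV \<times> Us \<times> Ws) (\<lambda>(x, v, \<omega>). V x v \<omega>) \<and>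
     (\<exists>\<alpha>3>0. \<exists>\<alpha>4>0. \<exists>\<alpha>5>0. \<exists>\<sigma>1. class_K \<sigma>1 \<and>
        (\<forall>x. \<forall>v\<in>Us. \<forall>\<omega>\<in>Ws. \<alpha>3 * (norm (x - p v \<omega>))\<^sup>2 \<le> V x v \<omega> \<and>
             V x v \<omega> \<le> \<alpha>4 * (norm (x - p v \<omega>))\<^sup>2) \<and>
        (\<forall>v\<in>Us. \<forall>w a b \<xi>. disturbance Ws w \<and> 0 \<le> a \<and> a < b \<and> plant_solution f v w a b \<xi> \<longrightarrow>
           (\<forall>t\<in>{a..b}. V (\<xi> t) v (w t) \<le> \<epsilon>x \<and> norm (signal_deriv w t) \<le> \<epsilon>w \<longrightarrow>
              (\<exists>D. ((\<lambda>s. V (\<xi> s) v (w s)) has_real_derivative D) (at t within {a..b}) \<and>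
                   D \<le> - \<alpha>5 * V (\<xi> t) v (w t) + \<sigma>1 (norm (signal_deriv w t))))))"

text \<open>The requirement that the disturbance is continuously differentiable with bounded derivative
  is part of \<^const>\<open>disturbance\<close>.\<close>

definition plant_assumptions ::
    "('x::euclidean_space \<Rightarrow> 'u::euclidean_space \<Rightarrow> 'w::euclidean_space \<Rightarrow> 'x)
     \<Rightarrow> ('x \<Rightarrow> 'w \<Rightarrow> 'y::euclidean_space) \<Rightarrow> ('u \<Rightarrow> 'w \<Rightarrow> 'x) \<Rightarrow> 'u set \<Rightarrow> 'w set
     \<Rightarrow> ('x \<Rightarrow> 'u \<Rightarrow> 'w \<Rightarrow> real) \<Rightarrow> real \<Rightarrow> real \<Rightarrow> bool" where
  "plant_assumptions f g p Us Ws V \<epsilon>x \<epsilon>w \<longleftrightarrow>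
     locally_lipschitz_on (UNIV \<times> Us \<times> Ws) (\<lambda>(x, v, \<omega>). f x v \<omega>) \<and>
     (\<exists>L. L-lipschitz_on (UNIV \<times> Ws) (\<lambda>(x, \<omega>). g x \<omega>)) \<and>
     compact Us \<and> convex Us \<and> compact Ws \<and> convex Ws \<and>
     plant_lyapunov f p Us Ws V \<epsilon>x \<epsilon>w"

section \<open>Generalized equation and algorithm\<close>

definition ss_output :: "('x \<Rightarrow> 'w \<Rightarrow> 'y) \<Rightarrow> ('u \<Rightarrow> 'w \<Rightarrow> 'x) \<Rightarrow> 'u \<Rightarrow> 'w \<Rightarrow> 'y" where
  "ss_output g p v \<omega> = g (p v \<omega>) \<omega>"

text \<open>Applied to \<open>G\<close> and to \<open>T\<close>, the next function gives the reduced maps \<open>G(z, h(q(z), w))\<close> and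
  \<open>T(z, h(q(z), w))\<close>.\<close>

definition reduced_map ::
    "('z \<Rightarrow> 'y \<Rightarrow> 'z) \<Rightarrow> ('x \<Rightarrow> 'w \<Rightarrow> 'y) \<Rightarrow> ('u \<Rightarrow> 'w \<Rightarrow> 'x) \<Rightarrow> ('z \<Rightarrow> 'u) \<Rightarrow> 'z \<Rightarrow> 'w \<Rightarrow> 'z" where
  "reduced_map H g p q z \<omega> = H z (ss_output g p (q z) \<omega>)"

definition ge_map ::
    "('z \<Rightarrow> 'y \<Rightarrow> 'z) \<Rightarrow> ('z \<Rightarrow> 'z set) \<Rightarrow> ('x \<Rightarrow> 'w \<Rightarrow> 'y) \<Rightarrow> ('u \<Rightarrow> 'w \<Rightarrow> 'x) \<Rightarrow> ('z \<Rightarrow> 'u) \<Rightarrow> 'w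
     \<Rightarrow> 'z \<Rightarrow> 'z::euclidean_space set" where
  "ge_map G A g p q \<omega> z = (\<lambda>a. reduced_map G g p q z \<omega> + a) ` A z"

definition solution_map ::
    "('z \<Rightarrow> 'y \<Rightarrow> 'z) \<Rightarrow> ('z \<Rightarrow> 'z set) \<Rightarrow> ('x \<Rightarrow> 'w \<Rightarrow> 'y) \<Rightarrow> ('u \<Rightarrow> 'w \<Rightarrow> 'x) \<Rightarrow> ('z \<Rightarrow> 'u) \<Rightarrow> 'w
     \<Rightarrow> 'z::euclidean_space set" where
  "solution_map G A g p q \<omega> = {z. 0 \<in> ge_map G A g p q \<omega> z}"

definition equation_assumptions ::
    "('z::euclidean_space \<Rightarrow> 'y::euclidean_space \<Rightarrow> 'z) \<Rightarrow> ('z \<Rightarrow> 'z set) \<Rightarrow> ('x \<Rightarrow> 'w \<Rightarrow> 'y)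
     \<Rightarrow> ('u \<Rightarrow> 'w \<Rightarrow> 'x) \<Rightarrow> ('z \<Rightarrow> 'u::euclidean_space) \<Rightarrow> 'w set \<Rightarrow> bool" where
  "equation_assumptions G A g p q Ws \<longleftrightarrow>
     (\<exists>L. L-lipschitz_on UNIV q) \<and>
     C1_on UNIV (\<lambda>(z, y). G z y) \<and>
     (\<forall>\<omega>\<in>Ws. \<forall>z\<in>solution_map G A g p q \<omega>. strongly_regular_at (ge_map G A g p q \<omega>) z 0)"

definition algorithm_assumptions ::
    "('z::euclidean_space \<Rightarrow> 'y::euclidean_space \<Rightarrow> 'z) \<Rightarrow> ('z \<Rightarrow> 'y \<Rightarrow> 'z) \<Rightarrow> ('z \<Rightarrow> 'z set)
     \<Rightarrow> ('x \<Rightarrow> 'w::euclidean_space \<Rightarrow> 'y) \<Rightarrow> ('u \<Rightarrow> 'w \<Rightarrow> 'x) \<Rightarrow> ('z \<Rightarrow> 'u) \<Rightarrow> 'w set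
     \<Rightarrow> ('z \<Rightarrow> 'w \<Rightarrow> real) \<Rightarrow> bool" where
  "algorithm_assumptions T G A g p q Ws W \<longleftrightarrow>
     (\<forall>\<omega>\<in>Ws. \<forall>z. z = reduced_map T g p q z \<omega> \<longleftrightarrow> z \<in> solution_map G A g p q \<omega>) \<and>
     continuous_on (UNIV \<times> Ws) (\<lambda>(z, \<omega>). W z \<omega>) \<and>
     (\<exists>\<epsilon>z>0. \<exists>\<alpha>1 \<alpha>2 \<alpha>. class_K_inf \<alpha>1 \<and> class_K_inf \<alpha>2 \<and> class_K \<alpha> \<and>
        (\<forall>\<omega>\<in>Ws. \<forall>zs\<in>solution_map G A g p q \<omega>. \<forall>z. norm (z - zs) \<le> \<epsilon>z \<longrightarrow>
           \<alpha>1 (norm (z - zs)) \<le> W z \<omega> \<and> W z \<omega> \<le> \<alpha>2 (norm (z - zs)) \<and>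
           W (reduced_map T g p q z \<omega>) \<omega> \<le> W z \<omega> - \<alpha> (norm (z - zs)))) \<and>
     (\<exists>L>0. \<forall>z s s'. norm (T z s - T z s') \<le> L * norm (s - s'))"

definition branch ::
    "('z::euclidean_space \<Rightarrow> 'y \<Rightarrow> 'z) \<Rightarrow> ('z \<Rightarrow> 'z set) \<Rightarrow> ('x \<Rightarrow> 'w::euclidean_space \<Rightarrow> 'y)
     \<Rightarrow> ('u \<Rightarrow> 'w \<Rightarrow> 'x) \<Rightarrow> ('z \<Rightarrow> 'u) \<Rightarrow> 'w set \<Rightarrow> ('w \<Rightarrow> 'z) \<Rightarrow> bool" where
  "branch G A g p q Ws zb \<longleftrightarrow>
     (\<exists>L. L-lipschitz_on Ws zb) \<and> (\<forall>\<omega>\<in>Ws. zb \<omega> \<in> solution_map G A g p q \<omega>)"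

section \<open>Plant and algorithm estimates\<close>

text \<open>\<open>\<epsilon>x\<close>, \<open>\<epsilon>w\<close> and \<open>V\<close> are those of \<^const>\<open>plant_assumptions\<close>. The comparison functions are
  uniform over all disturbance signals. Boundedness of the input increments is automatic, as the
  inputs take values in a compact set.\<close>

definition plant_estimate ::
    "('x::euclidean_space \<Rightarrow> 'u::euclidean_space \<Rightarrow> 'w::euclidean_space \<Rightarrow> 'x) \<Rightarrow> 'u set \<Rightarrow> 'w set
     \<Rightarrow> ('x \<Rightarrow> 'u \<Rightarrow> 'w \<Rightarrow> real) \<Rightarrow> real \<Rightarrow> real \<Rightarrow> real \<Rightarrow> (real \<Rightarrow> real) \<Rightarrow> bool" where
  "plant_estimate f Us Ws V \<epsilon>x \<epsilon>w \<tau> \<gamma>xu \<longleftrightarrow> class_L \<gamma>xu \<and>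
     (\<exists>\<beta>x \<gamma>xd \<pi>1 \<pi>2. class_KL \<beta>x \<and> class_KL \<gamma>xd \<and> \<pi>1 > 0 \<and> class_K \<pi>2 \<and>
        (\<forall>w x u. disturbance Ws w \<and> range u \<subseteq> Us \<and>
           (\<forall>k. x (Suc k) = plant_step f \<tau> w k (x k) (u k)) \<and>
           V (x 0) (u 0) (sample \<tau> w 0) \<le> 0.25 * \<epsilon>x \<and>
           seq_norm (\<lambda>k. u (Suc k) - u k) \<le> \<pi>1 * \<epsilon>x \<and>
           \<pi>2 (seq_norm (dist_seq \<tau> w)) \<le> \<epsilon>x \<and>
           seq_norm (dist_seq \<tau> w) \<le> \<epsilon>w \<longrightarrow>
           (\<forall>k. V (x k) (u k) (sample \<tau> w k) \<le>
                  \<beta>x (V (x 0) (u 0) (sample \<tau> w 0)) (real k * \<tau>)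
                  + \<gamma>xu \<tau> * seq_norm (\<lambda>k. u (Suc k) - u k)
                  + \<gamma>xd (seq_norm (dist_seq \<tau> w)) \<tau>)))"

text \<open>Here \<open>\<delta>x\<close> is an arbitrary exogenous sequence. The premise \<open>0 \<le> W z\<^sub>0 w\<^sub>0\<close> keeps the first
  argument of \<open>\<beta>z\<close> and \<open>\<beta>u\<close> in the domain of a class KL function; \<open>W\<close> may take negative values
  away from the solution set.\<close>

definition algorithm_estimate ::
    "('x::euclidean_space \<Rightarrow> 'u::euclidean_space \<Rightarrow> 'w::euclidean_space \<Rightarrow> 'x) \<Rightarrow> ('x \<Rightarrow> 'w \<Rightarrow> 'y)
     \<Rightarrow> ('u \<Rightarrow> 'w \<Rightarrow> 'x) \<Rightarrow> ('z \<Rightarrow> 'u) \<Rightarrow> ('z \<Rightarrow> 'y \<Rightarrow> 'z) \<Rightarrow> 'w set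
     \<Rightarrow> ('x \<Rightarrow> 'u \<Rightarrow> 'w \<Rightarrow> real) \<Rightarrow> ('z \<Rightarrow> 'w \<Rightarrow> real) \<Rightarrow> real \<Rightarrow> real \<Rightarrow> (real \<Rightarrow> real \<Rightarrow> real) \<Rightarrow> bool" where
  "algorithm_estimate f g p q T Ws V W \<tau> \<epsilon>2 \<gamma>ux \<longleftrightarrow> \<epsilon>2 > 0 \<and> class_KL \<gamma>ux \<and>
     (\<exists>\<epsilon>1>0. \<exists>\<epsilon>3>0. \<exists>\<beta>z \<beta>u \<gamma>zx \<gamma>zd \<gamma>ud.
        class_KL \<beta>z \<and> class_KL \<beta>u \<and> class_KL \<gamma>zx \<and> class_K \<gamma>zd \<and> class_K \<gamma>ud \<and>
        (\<forall>w x z u \<delta>x. let Vs = (\<lambda>k. V (x k) (u k) (sample \<tau> w k));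
                           Wl = (\<lambda>k. W (z k) (sample \<tau> w k));
                           d = seq_norm (dist_seq \<tau> w) in
           disturbance Ws w \<and>
           (\<forall>k. z (Suc k) = T (z k) (g (plant_step f \<tau> w k (x k) (u k)) (sample \<tau> w (Suc k)))) \<and>
           (\<forall>k. u k = q (z k)) \<and>
           (\<forall>k. x k = p (u k) (sample \<tau> w k) + \<delta>x k) \<and>
           0 \<le> Wl 0 \<and> Wl 0 \<le> \<epsilon>1 \<and> bdd_above (range Vs) \<and> (SUP k. Vs k) \<le> \<epsilon>2 \<and> d \<le> \<epsilon>3 \<longrightarrow>
           (\<forall>k. Wl k \<le> \<beta>z (Wl 0) (real k) + \<gamma>zx (SUP k. Vs k) \<tau> + \<gamma>zd d \<and>
                norm (u (Suc k) - u k) \<le> \<beta>u (Wl 0) (real k) + \<gamma>ux (SUP k. Vs k) \<tau> + \<gamma>ud d)))"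

section \<open>Closed loop\<close>

definition closed_loop ::
    "('x::euclidean_space \<Rightarrow> 'u \<Rightarrow> 'w \<Rightarrow> 'x) \<Rightarrow> ('x \<Rightarrow> 'w \<Rightarrow> 'y) \<Rightarrow> ('z \<Rightarrow> 'u) \<Rightarrow> ('z \<Rightarrow> 'y \<Rightarrow> 'z)
     \<Rightarrow> real \<Rightarrow> (real \<Rightarrow> 'w) \<Rightarrow> (nat \<Rightarrow> 'x) \<Rightarrow> (nat \<Rightarrow> 'y) \<Rightarrow> (nat \<Rightarrow> 'z) \<Rightarrow> (nat \<Rightarrow> 'u) \<Rightarrow> bool" where
  "closed_loop f g q T \<tau> w x y z u \<longleftrightarrow>
     (\<forall>k. x (Suc k) = plant_step f \<tau> w k (x k) (u k) \<and>
          y k = g (x k) (sample \<tau> w k) \<and>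
          z (Suc k) = T (z k) (y (Suc k)) \<and>
          u k = q (z k))"

text \<open>Lipschitz continuity of \<open>T\<close> in its second argument and a decrease of \<open>W\<close> do not
  exclude that \<open>T\<close> jumps from points arbitrarily close to one branch to another branch. Stability
  of the closed loop about a branch \<open>zb\<close> therefore additionally needs \<open>z \<mapsto> reduced_map T g p q z \<omega>\<close> to
  be continuous at \<open>zb \<omega>\<close>. This is also necessary: for a constant disturbance \<open>\<omega>\<close> and
  \<open>\<delta>x 0 = 0\<close>, the first closed-loop iterate is \<open>z 1 = reduced_map T g p q (z 0) \<omega>\<close>.\<close>

end

theory Submission
  imports Defs
begin

text \<open>By causality, (P) and (A) also hold with suprema over the past only: freeze the input after
  time \<open>k\<close> in (P), and put the plant at its steady state after time \<open>k\<close> in (A). The small-gain condition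
  then makes a small level of \<open>V\<close> invariant. That \<open>W\<close> is small controls the error \<open>e\<close> only once \<open>z\<close> is known
  to be near the branch; this is propagated from step to step by the continuity of the reduced map at
  \<open>zb \<omega>\<close>, uniform in \<open>\<omega>\<close>. This gives stability. The closed loop is time invariant, so the estimates can be
  restarted, and each restart lowers the eventual level of \<open>V\<close> by a fixed amount as long as it is bounded
  away from \<open>0\<close>, which gives attractivity. A class KL bound is extracted from these two properties.\<close>

section \<open>Comparison functions\<close>

text \<open>The hypotheses of (P) and (A) concern whole sequences: (A) may be used only once
  \<open>V\<close> is known to stay below \<epsilon>2 forever, and (P) only once all input
  increments are known to be small. Combining them directly is circular. The causal versions break
  the circle: the increment at time \<open>k\<close> depends on \<open>V\<close> up to
  \<open>k\<close>, while \<open>V\<close> at time \<open>k + 1\<close> depends on increments up to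
  \<open>k\<close>. The small-gain condition is strict but carries no uniform margin: the slack
  \<open>s - \<gamma>xu \<tau> * \<gamma>ux s \<tau>\<close> may vanish faster than linearly as
  \<open>s\<close> tends to 0. Therefore no decay rate is sought, and \<beta> and \<gamma> are not
  composed from the given comparison functions. Only qualitative stability and uniform attractivity
  are shown, and both comparison functions come from the single majorant of
  \<open>class_K_majorant\<close>.\<close>

lemma class_K_mono: "class_K \<gamma> \<Longrightarrow> 0 \<le> a \<Longrightarrow> a \<le> b \<Longrightarrow> \<gamma> a \<le> \<gamma> b"
  unfolding class_K_def strict_mono_on_def by (cases "a = b") (auto intro: less_imp_le)

lemma class_K_zero: "class_K \<gamma> \<Longrightarrow> \<gamma> 0 = 0"
  by (simp add: class_K_def)

lemma class_K_nonneg: "class_K \<gamma> \<Longrightarrow> 0 \<le> a \<Longrightarrow> 0 \<le> \<gamma> a"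
  using class_K_mono[of \<gamma> 0 a] by (simp add: class_K_zero)

lemma class_K_pos:
  assumes "class_K \<gamma>" "0 < a"
  shows "0 < \<gamma> a"
proof -
  have "\<gamma> 0 < \<gamma> a"
    using assms unfolding class_K_def strict_mono_on_def by (meson atLeast_iff less_imp_le order_refl)
  then show ?thesis
    using assms(1) by (simp add: class_K_zero)
qed

lemma class_K_le_cancel:
  assumes "class_K \<gamma>" "0 \<le> a" "0 \<le> b" "\<gamma> a \<le> \<gamma> b"
  shows "a \<le> b"
proof (rule ccontr)
  assume "\<not> a \<le> b"
  then have "\<gamma> b < \<gamma> a"
    using assms unfolding class_K_def strict_mono_on_def by auto
  with assms(4) show False by simp
qed

lemma class_K_tendsto_at_right:
  assumes "class_K \<gamma>"
  shows "(\<gamma> \<longlongrightarrow> 0) (at_right 0)"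
proof -
  have "(\<gamma> \<longlongrightarrow> \<gamma> 0) (at 0 within {0..})"
    using assms unfolding class_K_def continuous_on_def by (metis atLeast_iff order_refl)
  then have "(\<gamma> \<longlongrightarrow> \<gamma> 0) (at_right 0)"
    by (rule tendsto_within_subset) auto
  then show ?thesis
    using class_K_zero[OF assms] by simp
qed

lemma class_K_eventually_less:
  assumes "class_K \<gamma>" "0 < a"
  shows "\<forall>\<^sub>F s in at_right 0. \<gamma> s < a"
  using class_K_tendsto_at_right[OF assms(1)] assms(2) by (rule order_tendstoD)

lemma eventually_at_right_0_le:
  fixes a :: real
  assumes "0 < a"
  shows "\<forall>\<^sub>F s in at_right 0. s \<le> a"
  using assms by (auto simp: eventually_at_right intro!: exI[of _ a])

lemma class_K_compose_tendsto:
  assumes "class_K \<gamma>" "(h \<longlongrightarrow> 0) F" "eventually (\<lambda>t. 0 \<le> h t) F"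
  shows "((\<lambda>t. \<gamma> (h t)) \<longlongrightarrow> 0) F"
proof -
  have "((\<lambda>t. \<gamma> (h t)) \<longlongrightarrow> \<gamma> 0) F"
    using assms by (intro continuous_on_tendsto_compose[of "{0..}" \<gamma>]) (auto simp: class_K_def)
  then show ?thesis
    using assms(1) by (simp add: class_K_zero)
qed

text \<open>Nonnegativity is not part of \<open>class_L\<close>; it comes from the limit. The value
  at \<open>s + 1\<close> is at least the limit 0, and the value at \<open>s\<close> is strictly
  larger.\<close>

lemma class_L_pos:
  assumes "class_L \<sigma>" "0 \<le> s"
  shows "0 < \<sigma> s"
proof -
  have dec: "\<sigma> t < \<sigma> r" if "0 \<le> r" "r < t" for r t
    using assms(1) that by (simp add: class_L_def)
  have "eventually (\<lambda>t. \<sigma> t \<le> \<sigma> (s + 1)) at_top"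
    using eventually_gt_at_top[of "s + 1"]
  proof eventually_elim
    case (elim t)
    then show ?case using dec[of "s + 1" t] assms(2) by simp
  qed
  moreover have "(\<sigma> \<longlongrightarrow> 0) at_top"
    using assms(1) by (simp add: class_L_def)
  ultimately have "0 \<le> \<sigma> (s + 1)"
    by (intro tendsto_upperbound[of \<sigma> 0 at_top]) auto
  then show ?thesis
    using dec[of s "s + 1"] assms(2) by simp
qed

lemma class_KL_class_K: "class_KL \<beta> \<Longrightarrow> 0 \<le> t \<Longrightarrow> class_K (\<lambda>r. \<beta> r t)"
  by (simp add: class_KL_def)

lemma class_KL_mono: "class_KL \<beta> \<Longrightarrow> 0 \<le> t \<Longrightarrow> 0 \<le> r \<Longrightarrow> r \<le> r' \<Longrightarrow> \<beta> r t \<le> \<beta> r' t"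
  by (rule class_K_mono[of "\<lambda>r. \<beta> r t"]) (simp_all add: class_KL_def)

lemma class_KL_le_0:
  assumes "class_KL \<beta>" "0 \<le> t" "0 \<le> r"
  shows "\<beta> r t \<le> \<beta> r 0"
proof (cases "r = 0")
  case True
  then show ?thesis
    using assms class_K_zero[OF class_KL_class_K[of \<beta> t]] class_K_zero[OF class_KL_class_K[of \<beta> 0]] by simp
next
  case False
  then have "class_L (\<beta> r)"
    using assms by (simp add: class_KL_def)
  then show ?thesis
    using assms(2) by (cases "t = 0") (auto simp: class_L_def intro: less_imp_le)
qed

lemma class_KL_tendsto: "class_KL \<beta> \<Longrightarrow> 0 < r \<Longrightarrow> (\<beta> r \<longlongrightarrow> 0) at_top"
  by (simp add: class_KL_def class_L_def)

text \<open>Turns an epsilon-delta statement into one class K bound, although the relation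
  \<open>R\<close> offers no function to start from. The majorant is an infinite sum of ramps, the
  n-th of which takes care of values \<open>v\<close> of order \<open>(1/2) ^ n\<close>.\<close>

lemma class_K_majorant:
  fixes R :: "real \<Rightarrow> real \<Rightarrow> bool"
  assumes nonneg: "\<And>s v. R s v \<Longrightarrow> 0 \<le> s"
    and small: "\<And>\<eta>. 0 < \<eta> \<Longrightarrow> \<exists>\<delta>>0. \<forall>s v. R s v \<and> s \<le> \<delta> \<longrightarrow> v \<le> \<eta>"
  shows "\<exists>\<kappa> \<epsilon>. class_K \<kappa> \<and> 0 < \<epsilon> \<and> (\<forall>s v. R s v \<and> s \<le> \<epsilon> \<longrightarrow> v \<le> \<kappa> s)"
proof -
  have "\<exists>\<delta>>0. \<forall>s v. R s v \<and> s \<le> \<delta> \<longrightarrow> v \<le> (1/2) ^ n" for n :: nat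
    by (rule small) simp
  then obtain \<delta> :: "nat \<Rightarrow> real"
    where \<delta>: "\<And>n. 0 < \<delta> n" "\<And>n s v. R s v \<Longrightarrow> s \<le> \<delta> n \<Longrightarrow> v \<le> (1/2) ^ n"
    by metis
  \<comment> \<open>The n-th ramp saturates at \<open>2 * (1/2) ^ n\<close> when \<open>s\<close>
    reaches \<open>\<delta> n\<close>. The factor 2 pays for an index shift: for the first
    \<open>N\<close> with \<open>\<delta> N < s\<close>, only
    \<open>s \<le> \<delta> (N - 1)\<close> is available, hence
    \<open>v \<le> (1/2) ^ (N - 1)\<close>.\<close>
  define f where "f n s = 2 * (1/2) ^ n * min 1 (s / \<delta> n)" for n :: nat and s :: real
  \<comment> \<open>The summand \<open>s\<close> makes \<kappa> strictly increasing even where all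
    ramps are saturated.\<close>
  define \<kappa> where "\<kappa> s = s + (\<Sum>n. f n s)" for s
  have f_nonneg: "0 \<le> f n s" if "0 \<le> s" for n s
    using that \<delta>(1)[of n] by (simp add: f_def)
  have f_le: "f n s \<le> 2 * (1/2) ^ n" for n s
    using mult_left_mono[of "min 1 (s / \<delta> n)" 1 "2 * (1/2) ^ n"] by (simp add: f_def)
  have geom: "summable (\<lambda>n. 2 * (1/2) ^ n :: real)"
    by (intro summable_mult summable_geometric) simp
  have summ: "summable (\<lambda>n. f n s)" if "0 \<le> s" for s
    using f_nonneg[OF that] f_le by (intro summable_comparison_test'[OF geom, of 0]) simp
  have "uniform_limit {0..} (\<lambda>n s. \<Sum>i<n. f i s) (\<lambda>s. \<Sum>i. f i s) sequentially"
    using f_nonneg f_le by (intro Weierstrass_m_test[OF _ geom]) simp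
  moreover have "continuous_on {0..} (f n)" for n
    using \<delta>(1)[of n] unfolding f_def by (intro continuous_intros) auto
  then have "\<forall>\<^sub>F n in sequentially. continuous_on {0..} (\<lambda>s. \<Sum>i<n. f i s)"
    by (intro always_eventually allI continuous_on_sum)
  ultimately have "continuous_on {0..} (\<lambda>s. \<Sum>n. f n s)"
    by (intro uniform_limit_theorem[where F = sequentially]) auto
  then have "continuous_on {0..} \<kappa>"
    unfolding \<kappa>_def by (intro continuous_intros)
  moreover have "\<kappa> a < \<kappa> b" if "0 \<le> a" "a < b" for a b
  proof -
    have "f n a \<le> f n b" for n
      using that \<delta>(1)[of n] unfolding f_def
      by (intro mult_left_mono min.mono divide_right_mono) auto
    then have "(\<Sum>n. f n a) \<le> (\<Sum>n. f n b)"
      using that summ by (intro suminf_le) auto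
    with that show ?thesis by (simp add: \<kappa>_def)
  qed
  moreover have "\<kappa> 0 = 0"
    by (simp add: \<kappa>_def f_def)
  ultimately have K: "class_K \<kappa>"
    by (auto simp: class_K_def strict_mono_on_def)
  have "v \<le> \<kappa> s" if R: "R s v" and s: "s \<le> \<delta> 0" for s v
  proof (cases "v \<le> 0")
    case True
    then show ?thesis using class_K_nonneg[OF K nonneg[OF R]] by simp
  next
    case False
    then obtain n where "(1/2) ^ n < v"
      using real_arch_pow_inv[of v "1/2"] by auto
    then have ex: "\<exists>n. \<delta> n < s"
      using \<delta>(2)[OF R, of n] by (intro exI[of _ n]) linarith
    define N where "N = (LEAST n. \<delta> n < s)"
    have N1: "\<delta> N < s"
      unfolding N_def by (rule LeastI_ex[OF ex])
    have N2: "s \<le> \<delta> m" if "m < N" for m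
      using not_less_Least[OF that[unfolded N_def]] by simp
    \<comment> \<open>\<open>N\<close> is not 0 because \<open>s \<le> \<delta> 0\<close>; this is
      where the restriction to small \<open>s\<close> enters.\<close>
    from N1 s obtain m where m: "N = Suc m"
      by (cases N) auto
    have "v \<le> (1/2) ^ m"
      using \<delta>(2)[OF R] N2 m by simp
    also have "\<dots> = f N s"
      using N1 \<delta>(1)[of N] by (simp add: f_def m min_def)
    also have "\<dots> = sum (\<lambda>n. f n s) {N}" by simp
    also have "\<dots> \<le> (\<Sum>n. f n s)"
      by (rule sum_le_suminf[OF summ]) (use nonneg[OF R] f_nonneg in auto)
    also have "\<dots> \<le> \<kappa> s"
      using nonneg[OF R] by (simp add: \<kappa>_def)
    finally show ?thesis .
  qed
  with K \<delta>(1) show ?thesis by blast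
qed

text \<open>\<open>sqrt (r / (t + 1))\<close> is the geometric mean of \<open>r\<close> and
  \<open>1 / (t + 1)\<close>. It dominates their minimum and, unlike the minimum, is strictly
  monotone in \<open>r\<close> and, for positive \<open>r\<close>, in \<open>t\<close>, as class KL
  demands.\<close>

lemma class_KL_sqrt_divide:
  assumes "class_K \<kappa>"
  shows "class_KL (\<lambda>r t. \<kappa> (sqrt (r / (t + 1))))"
proof -
  have cont: "continuous_on {0..} \<kappa>"
    and strict: "\<And>a b. 0 \<le> a \<Longrightarrow> a < b \<Longrightarrow> \<kappa> a < \<kappa> b"
    using assms by (auto simp: class_K_def strict_mono_on_def)
  have "class_K (\<lambda>r. \<kappa> (sqrt (r / (t + 1))))" if "0 \<le> t" for t
    using that class_K_zero[OF assms] unfolding class_K_def strict_mono_on_def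
    by (auto intro!: continuous_on_compose2[OF cont] continuous_intros strict divide_strict_right_mono)
  moreover have "class_L (\<lambda>t. \<kappa> (sqrt (r / (t + 1))))" if "0 < r" for r
  proof -
    have "filterlim (\<lambda>t::real. t + 1) at_top at_top"
      by (rule filterlim_at_top_mono[OF filterlim_ident]) simp
    then have "((\<lambda>t. r / (t + 1)) \<longlongrightarrow> 0) at_top"
      by (intro tendsto_divide_0[OF tendsto_const] filterlim_at_top_imp_at_infinity)
    then have "((\<lambda>t. sqrt (r / (t + 1))) \<longlongrightarrow> 0) at_top"
      using tendsto_real_sqrt by fastforce
    moreover have "eventually (\<lambda>t. 0 \<le> sqrt (r / (t + 1))) at_top"
      by (rule eventually_mono[OF eventually_ge_at_top[of 0]]) (use that in simp)
    ultimately have "((\<lambda>t. \<kappa> (sqrt (r / (t + 1)))) \<longlongrightarrow> 0) at_top"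
      by (rule class_K_compose_tendsto[OF assms])
    then show ?thesis
      using that unfolding class_L_def
      by (auto intro!: continuous_on_compose2[OF cont] continuous_intros strict divide_strict_left_mono)
  qed
  ultimately show ?thesis by (simp add: class_KL_def)
qed

text \<open>Both hypotheses say that \<open>v\<close> is small once \<open>max d (min r (1 / (k + 1)))\<close> is small, so
  \<open>class_K_majorant\<close> applies to this single quantity.\<close>

lemma stable_attractive_imp_LISS:
  fixes R :: "real \<Rightarrow> real \<Rightarrow> nat \<Rightarrow> real \<Rightarrow> bool"
  assumes nonneg: "\<And>r d k v. R r d k v \<Longrightarrow> 0 \<le> r \<and> 0 \<le> d"
    and stable: "\<And>\<eta>. 0 < \<eta> \<Longrightarrow> \<exists>\<delta>>0. \<forall>r d k v. R r d k v \<and> r \<le> \<delta> \<and> d \<le> \<delta> \<longrightarrow> v \<le> \<eta>"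
    and attractive: "0 < \<epsilon>0" "\<And>\<eta>. 0 < \<eta> \<Longrightarrow>
      \<exists>\<delta>>0. \<exists>K. \<forall>r d k v. R r d k v \<and> r \<le> \<epsilon>0 \<and> d \<le> \<delta> \<and> K \<le> k \<longrightarrow> v \<le> \<eta>"
  shows "\<exists>\<epsilon>>0. \<exists>\<beta> \<gamma>. class_KL \<beta> \<and> class_K \<gamma> \<and>
      (\<forall>r d k v. R r d k v \<and> r \<le> \<epsilon> \<and> d \<le> \<epsilon> \<longrightarrow> v \<le> \<beta> r (real k) + \<gamma> d)"
proof -
  define Q where "Q s v \<longleftrightarrow> (\<exists>r d k. R r d k v \<and> r \<le> \<epsilon>0 \<and> s = max d (min r (1 / (real k + 1))))"
    for s v
  have "\<exists>\<kappa> \<epsilon>. class_K \<kappa> \<and> 0 < \<epsilon> \<and> (\<forall>s v. Q s v \<and> s \<le> \<epsilon> \<longrightarrow> v \<le> \<kappa> s)"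
  proof (rule class_K_majorant)
    show "0 \<le> s" if "Q s v" for s v
      using that nonneg by (auto simp: Q_def max_def)
    show "\<exists>\<delta>>0. \<forall>s v. Q s v \<and> s \<le> \<delta> \<longrightarrow> v \<le> \<eta>" if \<eta>: "0 < \<eta>" for \<eta>
    proof -
      obtain \<delta>1 where \<delta>1: "0 < \<delta>1"
        "\<And>r d k v. R r d k v \<Longrightarrow> r \<le> \<delta>1 \<Longrightarrow> d \<le> \<delta>1 \<Longrightarrow> v \<le> \<eta>"
        using stable[OF \<eta>] by blast
      obtain \<delta>2 K where \<delta>2: "0 < \<delta>2"
        "\<And>r d k v. R r d k v \<Longrightarrow> r \<le> \<epsilon>0 \<Longrightarrow> d \<le> \<delta>2 \<Longrightarrow> K \<le> k \<Longrightarrow> v \<le> \<eta>"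
        using attractive(2)[OF \<eta>] by blast
      define \<delta> where "\<delta> = min (min \<delta>1 \<delta>2) (1 / (real K + 1))"
      have "v \<le> \<eta>" if Q: "Q s v" and s: "s \<le> \<delta>" for s v
      proof -
        from Q obtain r d k where R: "R r d k v" "r \<le> \<epsilon>0" "s = max d (min r (1 / (real k + 1)))"
          by (auto simp: Q_def)
        have d: "d \<le> \<delta>1" "d \<le> \<delta>2"
          using R(3) s by (auto simp: \<delta>_def)
        show ?thesis
        proof (cases "r \<le> \<delta>1")
          case True
          then show ?thesis using \<delta>1(2) R(1) d(1) by blast
        next
          case False
          \<comment> \<open>Here \<open>r > \<delta>1 \<ge> \<delta>\<close>, so a minimum of at
            most \<delta> must be attained by \<open>1 / (real k + 1)\<close>: a small
            \<open>s\<close> with a large \<open>r\<close> means that the time is late.\<close>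
          then have "1 / (real k + 1) \<le> 1 / (real K + 1)"
            using R(3) s by (auto simp: \<delta>_def min_def max_def split: if_splits)
          then have "K \<le> k" by (simp add: field_simps)
          then show ?thesis using \<delta>2(2) R d(2) by blast
        qed
      qed
      moreover have "0 < \<delta>" using \<delta>1 \<delta>2 by (simp add: \<delta>_def)
      ultimately show ?thesis by blast
    qed
  qed
  then obtain \<kappa> \<epsilon>1 where \<kappa>: "class_K \<kappa>" "0 < \<epsilon>1"
    and bound: "\<And>s v. Q s v \<Longrightarrow> s \<le> \<epsilon>1 \<Longrightarrow> v \<le> \<kappa> s"
    by blast
  define \<epsilon> where "\<epsilon> = min \<epsilon>0 \<epsilon>1"
  have "v \<le> \<kappa> (sqrt (r / (real k + 1))) + \<kappa> d" if R: "R r d k v" and le: "r \<le> \<epsilon>" "d \<le> \<epsilon>" for r d k v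
  proof -
    define m where "m = min r (1 / (real k + 1))"
    have rd: "0 \<le> r" "0 \<le> d" using nonneg[OF R] by auto
    then have m: "0 \<le> m" by (simp add: m_def)
    have "m * m \<le> r * (1 / (real k + 1))"
      using rd m by (intro mult_mono) (auto simp: m_def)
    then have "m \<le> sqrt (r / (real k + 1))"
      using m by (intro real_le_rsqrt) (simp add: power2_eq_square)
    then have \<kappa>m: "\<kappa> m \<le> \<kappa> (sqrt (r / (real k + 1)))"
      using class_K_mono[OF \<kappa>(1) m] by blast
    have "v \<le> \<kappa> (max d m)"
      using R le by (intro bound) (auto simp: Q_def m_def \<epsilon>_def)
    also have "\<dots> \<le> \<kappa> d + \<kappa> m"
      using class_K_nonneg[OF \<kappa>(1)] rd m by (auto simp: max_def)
    finally show ?thesis using \<kappa>m by simp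
  qed
  moreover have "0 < \<epsilon>" using attractive(1) \<kappa>(2) by (simp add: \<epsilon>_def)
  ultimately show ?thesis
    using class_KL_sqrt_divide[OF \<kappa>(1)] \<kappa>(1) by blast
qed

section \<open>Small-gain argument for causal estimates\<close>

text \<open>\<open>V\<close>, \<open>W\<close>, \<open>D\<close>, \<open>E\<close> stand for the sequences of plant Lyapunov values, algorithm Lyapunov
  values, input increments and distances to the branch, and \<open>d\<close> for a bound on the disturbance.
  In contrast to the estimates (P) and (A), \<open>plant\<close> and \<open>algorithm\<close> are causal.\<close>

locale small_gain_loop =
  fixes traj :: "(nat \<Rightarrow> real) \<Rightarrow> (nat \<Rightarrow> real) \<Rightarrow> (nat \<Rightarrow> real) \<Rightarrow> (nat \<Rightarrow> real) \<Rightarrow> real \<Rightarrow> bool"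
    and \<beta>x \<beta>z \<beta>u :: "real \<Rightarrow> real \<Rightarrow> real"
    and \<gamma>xd \<gamma>zx \<gamma>ux \<gamma>zd \<gamma>ud \<alpha>1 \<alpha>2 :: "real \<Rightarrow> real"
    and c \<tau> v0 b0 \<epsilon>1 \<epsilon>2 d0 \<mu> \<epsilon>z :: real
  assumes KL: "class_KL \<beta>x" "class_KL \<beta>z" "class_KL \<beta>u"
    and K: "class_K \<gamma>xd" "class_K \<gamma>zx" "class_K \<gamma>ux" "class_K \<gamma>zd" "class_K \<gamma>ud" "class_K \<alpha>1" "class_K \<alpha>2"
    and pos: "0 < c" "0 < \<tau>" "0 < v0" "0 < b0" "0 < \<epsilon>1" "0 < \<epsilon>2" "0 < d0" "0 < \<mu>" "0 < \<epsilon>z"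
    and nonneg: "traj V W D E d \<Longrightarrow> 0 \<le> V k" "traj V W D E d \<Longrightarrow> 0 \<le> D k" "traj V W D E d \<Longrightarrow> 0 \<le> E k"
      "traj V W D E d \<Longrightarrow> 0 \<le> d"
    and shift: "traj V W D E d \<Longrightarrow>
      traj (\<lambda>k. V (n + k)) (\<lambda>k. W (n + k)) (\<lambda>k. D (n + k)) (\<lambda>k. E (n + k)) d"
    and plant: "\<lbrakk>traj V W D E d; V 0 \<le> v0; d \<le> d0; 0 \<le> B; B \<le> b0; \<forall>j<k. D j \<le> B\<rbrakk> \<Longrightarrow>
      V k \<le> \<beta>x (V 0) (real k * \<tau>) + c * B + \<gamma>xd d"
    and algorithm: "\<lbrakk>traj V W D E d; 0 \<le> W 0; W 0 \<le> \<epsilon>1; d \<le> d0; s \<le> \<epsilon>2; \<forall>j\<le>k. V j \<le> s\<rbrakk> \<Longrightarrow>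
      W k \<le> \<beta>z (W 0) (real k) + \<gamma>zx s + \<gamma>zd d \<and> D k \<le> \<beta>u (W 0) (real k) + \<gamma>ux s + \<gamma>ud d"
    and near: "\<lbrakk>traj V W D E d; E k \<le> \<mu>; D k \<le> \<mu>; V (Suc k) \<le> \<mu>; d \<le> \<mu>\<rbrakk> \<Longrightarrow> E (Suc k) \<le> \<epsilon>z"
    and sandwich: "traj V W D E d \<Longrightarrow> E k \<le> \<epsilon>z \<Longrightarrow> \<alpha>1 (E k) \<le> W k \<and> W k \<le> \<alpha>2 (E k)"
    and small_gain: "0 < s \<Longrightarrow> s \<le> v0 \<Longrightarrow> s \<le> \<epsilon>2 \<Longrightarrow> c * \<gamma>ux s < s"
begin

text \<open>The level \<open>s\<close> is invariant for \<open>V\<close> because the small-gain slack \<open>s - c * \<gamma>ux s\<close> absorbs the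
  initial and disturbance terms.\<close>

lemma stable:
  assumes \<eta>: "0 < \<eta>"
  shows "\<exists>\<delta>>0. \<forall>V W D E d. traj V W D E d \<and> V 0 \<le> \<delta> \<and> E 0 \<le> \<delta> \<and> d \<le> \<delta> \<longrightarrow>
    (\<forall>k. V k \<le> \<eta> \<and> D k \<le> \<eta> \<and> E k \<le> \<eta>)"
proof -
  \<comment> \<open>\<open>\<alpha>1 e\<close> will be the target level for \<open>W\<close>: it
    bounds \<open>E\<close> by \<open>e\<close> once \<open>E \<le> \<epsilon>z\<close> is known.
    The level \<open>b\<close> for the increments also respects the limit \<open>b0\<close> of the
    plant estimate.\<close>
  define e where "e = Min {\<eta>, \<mu>, \<epsilon>z}"
  define b where "b = Min {\<eta>, \<mu>, b0}"
  have e: "0 < e" "e \<le> \<eta>" "e \<le> \<mu>" "e \<le> \<epsilon>z" using \<eta> pos by (auto simp: e_def)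
  have b: "0 < b" "b \<le> \<eta>" "b \<le> \<mu>" "b \<le> b0" using \<eta> pos by (auto simp: b_def)
  have \<alpha>1e: "0 < \<alpha>1 e" using class_K_pos[OF K(6) e(1)] .
  have "\<forall>\<^sub>F s in at_right 0. 0 < s \<and> s \<le> Min {v0, \<epsilon>2, \<eta>, \<mu>} \<and> \<gamma>ux s < b / 2 \<and> \<gamma>zx s < \<alpha>1 e / 2"
    using \<eta> pos b(1) \<alpha>1e K
    by (intro eventually_conj class_K_eventually_less eventually_at_right_0_le eventually_at_right_less) auto
  then obtain s where s: "0 < s" "s \<le> v0" "s \<le> \<epsilon>2" "s \<le> \<eta>" "s \<le> \<mu>" "\<gamma>ux s < b / 2" "\<gamma>zx s < \<alpha>1 e / 2"
    by (auto dest!: eventually_happens)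
  define m where "m = s - c * \<gamma>ux s"
  have m: "0 < m" using small_gain[OF s(1-3)] by (simp add: m_def)
  have K0: "class_K (\<lambda>r. \<beta>x r 0)" "class_K (\<lambda>r. \<beta>z r 0)" "class_K (\<lambda>r. \<beta>u r 0)"
    using KL by (simp_all add: class_KL_def)
  have small2: "\<forall>\<^sub>F r in at_right 0. \<beta> (\<alpha>2 r) < a" if "class_K \<beta>" "0 < a" for \<beta> and a :: real
    using class_K_compose_tendsto[OF that(1) class_K_tendsto_at_right[OF K(7)]] that(2)
    by (rule order_tendstoD)
      (auto simp: eventually_at_right_less intro!: eventually_mono[OF eventually_at_right_less] class_K_nonneg[OF K(7)])
  have "\<forall>\<^sub>F r in at_right 0. 0 < r \<and> r \<le> Min {v0, d0, \<mu>, s, e, \<epsilon>z} \<and> \<alpha>2 r < \<epsilon>1 \<and>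
      \<beta>x r 0 < m / 4 \<and> \<beta>u (\<alpha>2 r) 0 < min (m / (4 * c)) (b / 4) \<and> \<gamma>ud r < min (m / (4 * c)) (b / 4) \<and> \<gamma>xd r < m / 4 \<and>
      \<beta>z (\<alpha>2 r) 0 < \<alpha>1 e / 4 \<and> \<gamma>zd r < \<alpha>1 e / 4"
    using s e b(1) \<alpha>1e m pos K
    by (intro eventually_conj class_K_eventually_less small2[OF K0(2)] small2[OF K0(3)] class_K_eventually_less[OF K0(1)] eventually_at_right_0_le eventually_at_right_less) auto
  \<comment> \<open>The slack \<open>m\<close> is spent in four quarters: the initial term of
    \<open>plant\<close>, the initial and the disturbance term of the increment bound (each
    multiplied by \<open>c\<close>), and the disturbance term of \<open>plant\<close>.\<close>
  then obtain \<delta> where \<delta>: "0 < \<delta>" "\<delta> \<le> v0" "\<delta> \<le> d0" "\<delta> \<le> \<mu>" "\<delta> \<le> s" "\<delta> \<le> e" "\<delta> \<le> \<epsilon>z" "\<alpha>2 \<delta> < \<epsilon>1"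
    "\<beta>x \<delta> 0 < m / 4" "\<beta>u (\<alpha>2 \<delta>) 0 < m / (4 * c)" "\<beta>u (\<alpha>2 \<delta>) 0 < b / 4"
    "\<gamma>ud \<delta> < m / (4 * c)" "\<gamma>ud \<delta> < b / 4" "\<gamma>xd \<delta> < m / 4" "\<beta>z (\<alpha>2 \<delta>) 0 < \<alpha>1 e / 4" "\<gamma>zd \<delta> < \<alpha>1 e / 4"
    by (auto dest!: eventually_happens)
  have "V k \<le> \<eta> \<and> D k \<le> \<eta> \<and> E k \<le> \<eta>"
    if t: "traj V W D E d" and V0: "V 0 \<le> \<delta>" and E0: "E 0 \<le> \<delta>" and d: "d \<le> \<delta>" for V W D E d k
  proof -
    note nn = nonneg[OF t]
    have W0: "\<alpha>1 (E 0) \<le> W 0" "W 0 \<le> \<alpha>2 (E 0)"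
      using sandwich[OF t, of 0] E0 \<delta>(7) by auto
    have W0_nonneg: "0 \<le> W 0" using W0(1) class_K_nonneg[OF K(6) nn(3)[of 0]] by linarith
    have W0_le: "W 0 \<le> \<alpha>2 \<delta>" using W0(2) class_K_mono[OF K(7) nn(3) E0] by linarith
    have \<beta>_le: "\<beta> (W 0) r \<le> \<beta> (\<alpha>2 \<delta>) 0" if "class_KL \<beta>" "0 \<le> r" for \<beta> r
      using class_KL_le_0[OF that W0_nonneg] class_KL_mono[OF that(1) order_refl W0_nonneg W0_le] by linarith
    have \<gamma>_le: "\<gamma> d \<le> \<gamma> \<delta>" if "class_K \<gamma>" for \<gamma>
      using class_K_mono[OF that nn(4) d] .
    define B where "B = \<beta>u (\<alpha>2 \<delta>) 0 + \<gamma>ux s + \<gamma>ud \<delta>"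
    have "0 \<le> \<alpha>2 \<delta>" using class_K_nonneg[OF K(7)] \<delta>(1) by simp
    then have B: "0 \<le> B" "B \<le> b"
      using class_K_nonneg[OF K0(3)] class_K_nonneg[OF K(3)] class_K_nonneg[OF K(5)] s \<delta>
      unfolding B_def by (auto intro!: add_nonneg_nonneg)
    have cB: "c * B < s - m / 2"
    proof -
      have "c * B < c * (m / (4 * c) + \<gamma>ux s + m / (4 * c))"
        unfolding B_def using \<delta> pos(1) by (intro mult_strict_left_mono) auto
      also have "\<dots> = s - m / 2" using pos(1) by (simp add: m_def field_simps)
      finally show ?thesis .
    qed
    have WD: "W k \<le> \<alpha>1 e \<and> D k \<le> B" if "\<forall>j\<le>k. V j \<le> s" for k
    proof -
      have "W k \<le> \<beta>z (W 0) (real k) + \<gamma>zx s + \<gamma>zd d" "D k \<le> \<beta>u (W 0) (real k) + \<gamma>ux s + \<gamma>ud d"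
        using algorithm[OF t W0_nonneg _ _ s(3) that] W0_le d \<delta> by auto
      then show ?thesis
        using \<beta>_le[OF KL(2), of "real k"] \<beta>_le[OF KL(3), of "real k"] \<gamma>_le[OF K(4)] \<gamma>_le[OF K(5)] s \<delta>
        unfolding B_def by (auto intro!: conjI; linarith)
    qed
    \<comment> \<open>The one-step lag makes this induction work: \<open>V\<close> up to
      \<open>k\<close> bounds \<open>D\<close> up to \<open>k\<close> by \<open>WD\<close>, which is
      all that \<open>plant\<close> needs for \<open>V (Suc k)\<close>.\<close>
    have Vs: "\<forall>j\<le>k. V j \<le> s" for k
    proof (induction k)
      case 0
      then show ?case using V0 \<delta>(5) by simp
    next
      case (Suc k)
      have "\<forall>j<Suc k. D j \<le> B"
        using WD Suc by (auto simp: less_Suc_eq_le)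
      then have "V (Suc k) \<le> \<beta>x (V 0) (real (Suc k) * \<tau>) + c * B + \<gamma>xd d"
        using V0 d \<delta> B b by (intro plant[OF t]) auto
      moreover have "\<beta>x (V 0) (real (Suc k) * \<tau>) \<le> \<beta>x \<delta> 0"
        using class_KL_le_0[OF KL(1) _ nn(1), of "real (Suc k) * \<tau>" 0] class_K_mono[OF K0(1) nn(1) V0] pos(2)
        by (simp del: of_nat_Suc)
      ultimately have "V (Suc k) \<le> s"
        using cB \<gamma>_le[OF K(1)] \<delta> by linarith
      with Suc show ?case by (auto simp: le_Suc_eq)
    qed
    have Vk: "V k \<le> s" and Dk: "D k \<le> b" and Wk: "W k \<le> \<alpha>1 e" for k
      using Vs WD[OF Vs] B(2) by (auto intro: order_trans)
    \<comment> \<open>\<open>near\<close> yields only the coarse bound \<epsilon>z. This makes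
      \<open>sandwich\<close> applicable, and the level of \<open>W\<close> then sharpens the bound
      to \<open>e\<close>, so that the induction can continue.\<close>
    have Ek: "E k \<le> e" for k
    proof (induction k)
      case 0
      then show ?case using E0 \<delta>(6) by simp
    next
      case (Suc k)
      have "E (Suc k) \<le> \<epsilon>z"
        using Suc Vk[of "Suc k"] Dk[of k] d e b s \<delta> by (intro near[OF t]) auto
      then have "\<alpha>1 (E (Suc k)) \<le> \<alpha>1 e"
        using sandwich[OF t, of "Suc k"] Wk[of "Suc k"] by linarith
      then show ?case
        using class_K_le_cancel[OF K(6) nn(3)] e(1) by simp
    qed
    show ?thesis
      using Vk[of k] Dk[of k] Ek[of k] s b e by linarith
  qed
  with \<delta>(1) show ?thesis by blast
qed

text \<open>Restarting the estimates at later times lowers the eventual level of \<open>V\<close> by the minimal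
  small-gain slack on a compact interval, hence below any positive level after finitely many rounds.\<close>

lemma attractive:
  shows "\<exists>\<epsilon>>0. \<forall>\<eta>>0. \<exists>\<delta>>0. \<exists>N. \<forall>V W D E d. traj V W D E d \<and> V 0 \<le> \<epsilon> \<and> E 0 \<le> \<epsilon> \<and> d \<le> \<delta> \<longrightarrow>
    (\<forall>k\<ge>N. V k \<le> \<eta> \<and> E k \<le> \<eta>)"
proof -
  have "\<forall>\<^sub>F s in at_right 0. 0 < s \<and> s \<le> Min {v0, \<epsilon>2, b0, \<epsilon>z} \<and> \<alpha>2 s < \<epsilon>1"
    using pos K by (intro eventually_conj class_K_eventually_less eventually_at_right_0_le eventually_at_right_less) auto
  then obtain e0 where e0: "0 < e0" "e0 \<le> v0" "e0 \<le> \<epsilon>2" "e0 \<le> b0" "e0 \<le> \<epsilon>z" "\<alpha>2 e0 < \<epsilon>1"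
    by (auto dest!: eventually_happens)
  \<comment> \<open>Every state of a good trajectory can serve as an initial state of the estimates:
    \<open>E\<close> stays below \<open>e0\<close>, hence \<open>W\<close> stays between 0 and
    \<omega>, and the transients after a restart are bounded by \<open>\<beta>z \<omega>\<close> and
    \<open>\<beta>u \<omega>\<close> whatever the trajectory.\<close>
  define \<omega> where "\<omega> = \<alpha>2 e0"
  have \<omega>: "0 < \<omega>" "\<omega> \<le> \<epsilon>1" using class_K_pos[OF K(7) e0(1)] e0(6) by (auto simp: \<omega>_def)
  obtain \<epsilon>s where \<epsilon>s: "0 < \<epsilon>s" "\<And>V W D E d k. traj V W D E d \<Longrightarrow> V 0 \<le> \<epsilon>s \<Longrightarrow> E 0 \<le> \<epsilon>s \<Longrightarrow> d \<le> \<epsilon>s \<Longrightarrow>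
      V k \<le> e0 \<and> D k \<le> e0 \<and> E k \<le> e0"
    using stable[OF e0(1)] by blast
  define \<epsilon> where "\<epsilon> = min \<epsilon>s d0"
  have \<epsilon>: "0 < \<epsilon>" "\<epsilon> \<le> \<epsilon>s" "\<epsilon> \<le> d0" using \<epsilon>s pos by (auto simp: \<epsilon>_def)
  define good where "good V W D E d \<longleftrightarrow> traj V W D E d \<and> V 0 \<le> \<epsilon> \<and> E 0 \<le> \<epsilon> \<and> d \<le> \<epsilon>" for V W D E d
  have good: "traj V W D E d" "0 \<le> d" "d \<le> d0" "0 \<le> V k" "V k \<le> e0" "D k \<le> e0" "0 \<le> E k" "E k \<le> e0" "0 \<le> W k" "W k \<le> \<omega>"
    if "good V W D E d" for V W D E d k
  proof -
    show t: "traj V W D E d" and "d \<le> d0"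
      using that \<epsilon> by (auto simp: good_def)
    show "0 \<le> d" "0 \<le> V k" and E: "0 \<le> E k" using nonneg[OF t] by auto
    show "V k \<le> e0" "D k \<le> e0" and E': "E k \<le> e0"
      using \<epsilon>s(2)[OF t] that \<epsilon> by (auto simp: good_def)
    have "\<alpha>1 (E k) \<le> W k" "W k \<le> \<alpha>2 (E k)" using sandwich[OF t, of k] E' e0(5) by auto
    then show "0 \<le> W k" "W k \<le> \<omega>"
      using class_K_nonneg[OF K(6) E] class_K_mono[OF K(7) E E'] by (auto simp: \<omega>_def)
  qed
  have plant_restart: "V (n + i) \<le> \<beta>x e0 (real i * \<tau>) + c * B + \<gamma>xd d"
    if g: "good V W D E d" and B: "0 \<le> B" and D: "\<forall>j\<ge>n. D j \<le> B" for V W D E d n i B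
  proof -
    \<comment> \<open>The plant estimate admits increment bounds up to \<open>b0\<close> only.
      Increments never exceed \<open>e0 \<le> b0\<close>, so \<open>min B b0\<close> is also a bound
      and \<open>B\<close> may be arbitrarily large.\<close>
    have cB: "c * min B b0 \<le> c * B" using pos(1) by (intro mult_left_mono) auto
    have "V (n + i) \<le> \<beta>x (V (n + 0)) (real i * \<tau>) + c * min B b0 + \<gamma>xd d"
      using good[OF g] B D pos e0 by (intro plant[OF shift[OF good(1)[OF g]]]) (auto intro: order_trans)
    moreover have "\<beta>x (V (n + 0)) (real i * \<tau>) \<le> \<beta>x e0 (real i * \<tau>)"
      using good[OF g] pos by (intro class_KL_mono[OF KL(1)]) auto
    ultimately show ?thesis using cB by linarith
  qed
  have algorithm_restart: "W (n + i) \<le> \<beta>z \<omega> (real i) + \<gamma>zx s + \<gamma>zd d \<and> D (n + i) \<le> \<beta>u \<omega> (real i) + \<gamma>ux s + \<gamma>ud d"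
    if g: "good V W D E d" and s: "s \<le> \<epsilon>2" and V: "\<forall>j\<ge>n. V j \<le> s" for V W D E d n i s
  proof -
    have "W (n + i) \<le> \<beta>z (W (n + 0)) (real i) + \<gamma>zx s + \<gamma>zd d \<and> D (n + i) \<le> \<beta>u (W (n + 0)) (real i) + \<gamma>ux s + \<gamma>ud d"
      using algorithm[OF shift[OF good(1)[OF g], of n] _ _ good(3)[OF g] s, of i] good(9,10)[OF g, of n] \<omega>(2) V
      by auto
    moreover have "\<beta> (W (n + 0)) (real i) \<le> \<beta> \<omega> (real i)" if "class_KL \<beta>" for \<beta>
      using good[OF g] by (intro class_KL_mono[OF that]) auto
    ultimately show ?thesis using KL by (meson add_right_mono order_trans)
  qed
  have eventually_small: "\<exists>I::nat. \<forall>i\<ge>I. \<beta> r (real i * a) \<le> x"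
    if "class_KL \<beta>" "0 < r" "0 < a" "0 < x" for \<beta> and r a x :: real
  proof -
    have "((\<lambda>i. \<beta> r (real i * a)) \<longlongrightarrow> 0) sequentially"
      using that(3) by (intro filterlim_compose[OF class_KL_tendsto[OF that(1,2)]]
          filterlim_at_top_mult_tendsto_pos[OF tendsto_const] filterlim_real_sequentially)
    then have "\<forall>\<^sub>F i in sequentially. \<beta> r (real i * a) < x"
      using that(4) by (rule order_tendstoD)
    then show ?thesis by (auto simp: eventually_sequentially intro: less_imp_le)
  qed
  have small_d: "\<exists>\<delta>>0. \<delta> \<le> \<epsilon> \<and> \<gamma> \<delta> \<le> a \<and> \<gamma>' \<delta> \<le> a"
    if "class_K \<gamma>" "class_K \<gamma>'" "0 < a" for \<gamma> \<gamma>' and a :: real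
  proof -
    have "\<forall>\<^sub>F s in at_right 0. 0 < s \<and> s \<le> \<epsilon> \<and> \<gamma> s < a \<and> \<gamma>' s < a"
      using that \<epsilon>(1) by (intro eventually_conj class_K_eventually_less eventually_at_right_0_le eventually_at_right_less) auto
    then show ?thesis by (auto dest!: eventually_happens intro: less_imp_le)
  qed
  \<comment> \<open>\<delta> and \<open>N\<close> are uniform over all good trajectories; a class KL
    bound cannot be extracted without this uniformity.\<close>
  define level where "level s \<longleftrightarrow> (\<exists>\<delta>>0. \<exists>N. \<forall>V W D E d. good V W D E d \<and> d \<le> \<delta> \<longrightarrow> (\<forall>k\<ge>N. V k \<le> s))" for s
  have level_le: "level s'" if "level s" "s \<le> s'" for s s'
    using that unfolding level_def by (meson order_trans)
  have level_small: "level \<eta>" if \<eta>: "0 < \<eta>" "\<eta> \<le> e0" for \<eta>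
  proof -
    have "continuous_on {\<eta>..e0} (\<lambda>s. s - c * \<gamma>ux s)"
      using K(3) \<eta> by (intro continuous_intros) (auto simp: class_K_def intro: continuous_on_subset)
    then obtain s1 where s1: "s1 \<in> {\<eta>..e0}" "\<And>s. s \<in> {\<eta>..e0} \<Longrightarrow> s1 - c * \<gamma>ux s1 \<le> s - c * \<gamma>ux s"
      using continuous_attains_inf[of "{\<eta>..e0}" "\<lambda>s. s - c * \<gamma>ux s"] \<eta>(2) by auto
    \<comment> \<open>Compactness of the interval, which stays away from 0, turns the pointwise
      strict small-gain inequality into one positive slack.\<close>
    define m where "m = s1 - c * \<gamma>ux s1"
    have m: "0 < m" using small_gain[of s1] s1(1) \<eta>(1) e0 by (auto simp: m_def)
    have step: "level (s - m / 2)" if lev: "level s" and s: "\<eta> \<le> s" "s \<le> e0" for s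
    proof -
      obtain \<delta>1 N where N: "0 < \<delta>1" "\<And>V W D E d k. good V W D E d \<Longrightarrow> d \<le> \<delta>1 \<Longrightarrow> N \<le> k \<Longrightarrow> V k \<le> s"
        using lev unfolding level_def by blast
      \<comment> \<open>Four errors of size at most \<open>m / 8\<close> will occur: two transients
        and two disturbance terms, those inside the increment bound multiplied by \<open>c\<close>.
        Half of the slack \<open>m\<close> remains as the gain of the round.\<close>
      define a where "a = min (m / 8) (m / (8 * c))"
      have a: "0 < a" "a \<le> m / 8" "c * a \<le> m / 8"
        using m pos(1) by (auto simp: a_def min_def field_simps)
      obtain I where I: "\<And>i. I \<le> i \<Longrightarrow> \<beta>u \<omega> (real i * 1) \<le> a"
        using eventually_small[OF KL(3) \<omega>(1) _ a(1), of 1] by auto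
      obtain J where J: "\<And>i. J \<le> i \<Longrightarrow> \<beta>x e0 (real i * \<tau>) \<le> a"
        using eventually_small[OF KL(1) e0(1) pos(2) a(1)] by auto
      obtain \<delta>2 where \<delta>2: "0 < \<delta>2" "\<gamma>ud \<delta>2 \<le> a" "\<gamma>xd \<delta>2 \<le> a"
        using small_d[OF K(5) K(1) a(1)] by blast
      \<comment> \<open>The waiting times add up: \<open>N\<close> until \<open>V \<le> s\<close>,
        then \<open>I\<close> until the transient of the increments has died out, then
        \<open>J\<close> for the transient of the plant restarted at \<open>N + I\<close>.\<close>
      have "V k \<le> s - m / 2" if g: "good V W D E d" and d: "d \<le> min \<delta>1 \<delta>2" and k: "N + I + J \<le> k" for V W D E d k
      proof -
        have V: "\<forall>j\<ge>N. V j \<le> s" using N(2)[OF g] d by auto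
        have \<gamma>: "\<gamma>ud d \<le> a" "\<gamma>xd d \<le> a"
          using class_K_mono[OF K(5) good(2)[OF g], of \<delta>2] class_K_mono[OF K(1) good(2)[OF g], of \<delta>2] d \<delta>2 by auto
        have "D j \<le> \<gamma>ux s + 2 * a" if "N + I \<le> j" for j
        proof -
          have "D (N + (j - N)) \<le> \<beta>u \<omega> (real (j - N)) + \<gamma>ux s + \<gamma>ud d"
            using algorithm_restart[OF g _ V, of "j - N"] s e0 by auto
          moreover have "\<beta>u \<omega> (real (j - N)) \<le> a"
            using I[of "j - N"] that by simp
          ultimately show ?thesis using that \<gamma>(1) by simp
        qed
        moreover have "0 \<le> \<gamma>ux s + 2 * a"
          using class_K_nonneg[OF K(3)] s \<eta> a by (auto intro!: add_nonneg_nonneg)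
        ultimately have "V (N + I + (k - (N + I))) \<le> \<beta>x e0 (real (k - (N + I)) * \<tau>) + c * (\<gamma>ux s + 2 * a) + \<gamma>xd d"
          by (intro plant_restart[OF g]) auto
        moreover have "\<beta>x e0 (real (k - (N + I)) * \<tau>) \<le> a"
          using k by (intro J) auto
        moreover have "m \<le> s - c * \<gamma>ux s"
          using s1(2)[of s] s by (simp add: m_def)
        ultimately show ?thesis
          using k \<gamma>(2) a by (simp add: distrib_left)
      qed
      then show ?thesis
        unfolding level_def using N(1) \<delta>2(1) by (intro exI[of _ "min \<delta>1 \<delta>2"] conjI exI[of _ "N + I + J"]) auto
    qed
    \<comment> \<open>The descent is cut off at \<eta> because the slack \<open>m\<close> is
      guaranteed only for levels between \<eta> and \<open>e0\<close>.\<close>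
    have levels: "level (max \<eta> (e0 - real n * (m / 2)))" for n
    proof (induction n)
      case 0
      have "level e0"
        unfolding level_def using good(5) by (intro exI[of _ 1]) auto
      then show ?case by (rule level_le) auto
    next
      case (Suc n)
      let ?s = "max \<eta> (e0 - real n * (m / 2))"
      have "level (?s - m / 2)"
        using m \<eta> by (intro step Suc) auto
      moreover have "e0 - real (Suc n) * (m / 2) = e0 - real n * (m / 2) - m / 2"
        by (simp add: algebra_simps)
      then have "?s - m / 2 \<le> max \<eta> (e0 - real (Suc n) * (m / 2))"
        using m by (simp add: max_def del: of_nat_Suc)
      ultimately show ?case by (rule level_le)
    qed
    obtain n :: nat where "e0 / (m / 2) < real n"
      using reals_Archimedean2 by blast
    then have "e0 - real n * (m / 2) \<le> \<eta>"
      using m \<eta> by (simp add: field_simps)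
    then show ?thesis using levels[of n] by (simp only: max_absorb1)
  qed
  have "\<exists>\<delta>>0. \<exists>N. \<forall>V W D E d. traj V W D E d \<and> V 0 \<le> \<epsilon> \<and> E 0 \<le> \<epsilon> \<and> d \<le> \<delta> \<longrightarrow>
      (\<forall>k\<ge>N. V k \<le> \<eta> \<and> E k \<le> \<eta>)" if \<eta>: "0 < \<eta>" for \<eta>
  proof -
    define a where "a = \<alpha>1 \<eta> / 3"
    have a: "0 < a" using class_K_pos[OF K(6) \<eta>] by (simp add: a_def)
    have "\<forall>\<^sub>F s in at_right 0. 0 < s \<and> s \<le> Min {\<eta>, e0} \<and> \<gamma>zx s < a"
      using \<eta> e0 a K by (intro eventually_conj class_K_eventually_less eventually_at_right_0_le eventually_at_right_less) auto
    then obtain s where s: "0 < s" "s \<le> \<eta>" "s \<le> e0" "\<gamma>zx s < a"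
      by (auto dest!: eventually_happens)
    obtain \<delta>1 N where N: "0 < \<delta>1" "\<And>V W D E d k. good V W D E d \<Longrightarrow> d \<le> \<delta>1 \<Longrightarrow> N \<le> k \<Longrightarrow> V k \<le> s"
      using level_small[OF s(1,3)] unfolding level_def by blast
    obtain I where I: "\<And>i. I \<le> i \<Longrightarrow> \<beta>z \<omega> (real i * 1) \<le> a"
      using eventually_small[OF KL(2) \<omega>(1) _ a, of 1] by auto
    obtain \<delta>2 where \<delta>2: "0 < \<delta>2" "\<delta>2 \<le> \<epsilon>" "\<gamma>zd \<delta>2 \<le> a"
      using small_d[OF K(4) K(4) a] by blast
    have "V k \<le> \<eta> \<and> E k \<le> \<eta>"
      if t: "traj V W D E d" "V 0 \<le> \<epsilon>" "E 0 \<le> \<epsilon>" and d: "d \<le> min \<delta>1 \<delta>2" and k: "N + I \<le> k" for V W D E d k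
    proof -
      have g: "good V W D E d" using t d \<delta>2 by (auto simp: good_def)
      have V: "\<forall>j\<ge>N. V j \<le> s" using N(2)[OF g] d by auto
      have "W (N + (k - N)) \<le> \<beta>z \<omega> (real (k - N)) + \<gamma>zx s + \<gamma>zd d"
        using algorithm_restart[OF g _ V, of "k - N"] s e0 by auto
      moreover have "\<gamma>zd d \<le> a"
        using class_K_mono[OF K(4) good(2)[OF g], of \<delta>2] d \<delta>2 by auto
      moreover have "\<beta>z \<omega> (real (k - N)) \<le> a"
        using I[of "k - N"] k by simp
      ultimately have "W k \<le> \<alpha>1 \<eta>"
        using k s(4) by (simp add: a_def)
      moreover have "\<alpha>1 (E k) \<le> W k"
        using sandwich[OF t(1), of k] good(8)[OF g, of k] e0(5) by auto
      ultimately have "E k \<le> \<eta>"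
        using class_K_le_cancel[OF K(6) good(7)[OF g], of \<eta>] \<eta> by auto
      moreover have "V k \<le> \<eta>" using V k s(2) by (meson add_leD1 order_trans)
      ultimately show ?thesis by simp
    qed
    then show ?thesis
      using N(1) \<delta>2(1) by (intro exI[of _ "min \<delta>1 \<delta>2"] conjI exI[of _ "N + I"]) auto
  qed
  with \<epsilon>(1) show ?thesis by blast
qed

end

section \<open>Disturbance signals and time shifts\<close>

text \<open>The set where \<open>h \<le> M\<close> is closed and has full measure in the open
  interval, so it contains that interval and, by closure, the endpoints. Essential suprema of the
  continuous derivative thereby become pointwise bounds.\<close>

lemma continuous_AE_le_imp_le:
  fixes h :: "real \<Rightarrow> real"
  assumes cont: "continuous_on {a..b} h" and "a < b"
    and AE: "AE t in restrict_space lborel {a..b}. h t \<le> M" and t: "t \<in> {a..b}"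
  shows "h t \<le> M"
proof -
  define C where "C = {a..b} \<inter> h -` {..M}"
  have C: "closed C"
    unfolding C_def by (rule continuous_closed_preimage[OF cont]) auto
  have "AE t in lborel. t \<in> {a<..<b} \<longrightarrow> t \<in> C"
    using AE by (simp add: AE_restrict_space_iff C_def) (auto elim!: eventually_mono)
  then have "s \<in> C" if "s \<in> {a<..<b}" for s
    using that C by (intro mem_closed_if_AE_lebesgue_open[of "{a<..<b}" C]) (auto intro: AE_completion)
  then have "closure {a<..<b} \<subseteq> C"
    using C by (intro closure_minimal) auto
  then show ?thesis
    using t \<open>a < b\<close> by (auto simp: C_def)
qed

lemma disturbance_has_vector_derivative:
  assumes "disturbance Ws w" "0 \<le> t"
  shows "(w has_vector_derivative signal_deriv w t) (at t within {0..})"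
  using assms vector_derivative_works unfolding disturbance_def signal_deriv_def by blast

lemma disturbance_norm_deriv_continuous:
  assumes "disturbance Ws w"
  shows "continuous_on {0..} (\<lambda>t. norm (signal_deriv w t))"
  using assms by (auto simp: disturbance_def intro!: continuous_intros)

lemma disturbance_deriv_bounded:
  assumes w: "disturbance Ws w"
  obtains M where "\<And>t. 0 \<le> t \<Longrightarrow> norm (signal_deriv w t) \<le> M"
proof -
  let ?e = "esssup (restrict_space lborel {0..}) (\<lambda>t. ereal (norm (signal_deriv w t)))"
  have fin: "?e < \<infinity>" using w by (simp add: disturbance_def)
  have "AE t in restrict_space lborel {0..}. ereal (norm (signal_deriv w t)) \<le> ?e"
    by (rule esssup_AE)
  then have AE: "AE t in lborel. 0 \<le> t \<longrightarrow> norm (signal_deriv w t) \<le> real_of_ereal ?e"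
    using fin by (cases ?e) (auto simp: AE_restrict_space_iff elim!: eventually_mono)
  have "norm (signal_deriv w t) \<le> real_of_ereal ?e" if "0 \<le> t" for t
  proof (rule continuous_AE_le_imp_le[of 0 "t + 1" "\<lambda>t. norm (signal_deriv w t)"])
    show "continuous_on {0..t + 1} (\<lambda>t. norm (signal_deriv w t))"
      by (rule continuous_on_subset[OF disturbance_norm_deriv_continuous[OF w]]) auto
    show "AE t in restrict_space lborel {0..t + 1}. norm (signal_deriv w t) \<le> real_of_ereal ?e"
      using AE by (auto simp: AE_restrict_space_iff elim!: eventually_mono)
  qed (use that in auto)
  then show thesis by (rule that)
qed

text \<open>Measurability has to be checked, since \<open>esssup\<close> of a function that is not
  measurable is the top element.\<close>

lemma esssup_continuous_le:
  fixes h :: "real \<Rightarrow> real"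
  assumes h: "continuous_on S h" and S: "S \<in> sets borel" and M: "\<And>t. t \<in> S \<Longrightarrow> h t \<le> M"
  shows "esssup (restrict_space lborel S) (\<lambda>t. ereal (h t)) \<le> ereal M"
proof (rule esssup_I)
  have "h \<in> borel_measurable (restrict_space borel S)"
    by (rule borel_measurable_continuous_on_restrict[OF h])
  then show "(\<lambda>t. ereal (h t)) \<in> borel_measurable (restrict_space lborel S)"
    by (subst measurable_cong_sets[OF sets_restrict_space_cong[OF sets_lborel] refl])
      (rule borel_measurable_ereal)
  show "AE t in restrict_space lborel S. ereal (h t) \<le> ereal M"
    using M by (intro AE_I2) (auto simp: space_restrict_space)
qed

text \<open>\<open>real_of_ereal\<close> maps both infinities to 0, so \<open>dist_seq\<close>
  bounds the derivative only after the essential supremum has been shown to be less than infinity.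
  The global bound \<open>M\<close> provides this.\<close>

lemma dist_seq_bounds:
  assumes w: "disturbance Ws w" and \<tau>: "0 < \<tau>"
    and M: "\<And>t. 0 \<le> t \<Longrightarrow> norm (signal_deriv w t) \<le> M"
  shows "t \<in> {real k * \<tau>..real (Suc k) * \<tau>} \<Longrightarrow> norm (signal_deriv w t) \<le> dist_seq \<tau> w k"
    and "0 \<le> dist_seq \<tau> w k" and "dist_seq \<tau> w k \<le> M"
proof -
  let ?S = "{real k * \<tau>..real (Suc k) * \<tau>}"
  let ?e = "esssup (restrict_space lborel ?S) (\<lambda>t. ereal (norm (signal_deriv w t)))"
  have S: "?S \<subseteq> {0..}" using \<tau> by (auto intro: order_trans[rotated])
  have le: "?e \<le> ereal M"
    using S M by (intro esssup_continuous_le continuous_on_subset[OF disturbance_norm_deriv_continuous[OF w]]) auto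
  have "AE t in restrict_space lborel ?S. ereal (norm (signal_deriv w t)) \<le> ?e"
    by (rule esssup_AE)
  then have AE: "AE t in restrict_space lborel ?S. norm (signal_deriv w t) \<le> dist_seq \<tau> w k"
    using le unfolding dist_seq_def by (cases ?e) (auto elim!: eventually_mono)
  show *: "norm (signal_deriv w t) \<le> dist_seq \<tau> w k" if "t \<in> ?S" for t
    using \<tau> by (intro continuous_AE_le_imp_le[OF _ _ AE that]
        continuous_on_subset[OF disturbance_norm_deriv_continuous[OF w] S]) simp
  have "real k * \<tau> \<in> ?S" using \<tau> by simp
  then show nonneg: "0 \<le> dist_seq \<tau> w k"
    using * norm_ge_zero order_trans by blast
  \<comment> \<open>Covers the case of an essential supremum equal to minus infinity, which
    \<open>real_of_ereal\<close> turns into 0.\<close>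
  have "0 \<le> M" using M[of 0] norm_ge_zero[of "signal_deriv w 0"] by (meson order_refl order_trans)
  then show "dist_seq \<tau> w k \<le> M"
    using le unfolding dist_seq_def by (cases ?e) auto
qed

lemma seq_norm_dist_seq_le:
  assumes w: "disturbance Ws w" and \<tau>: "0 < \<tau>"
    and M: "\<And>t. 0 \<le> t \<Longrightarrow> norm (signal_deriv w t) \<le> M"
  shows "seq_norm (dist_seq \<tau> w) \<le> M"
  unfolding seq_norm_def using dist_seq_bounds(2,3)[OF w \<tau> M] by (intro cSUP_least) auto

lemma norm_signal_deriv_le:
  assumes w: "disturbance Ws w" and \<tau>: "0 < \<tau>" and t: "0 \<le> t"
  shows "norm (signal_deriv w t) \<le> seq_norm (dist_seq \<tau> w)"
proof -
  \<comment> \<open>The norm of the sequence is a real-valued \<open>SUP\<close>, which is an upper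
    bound only for bounded sequences; hence a global bound comes first.\<close>
  obtain M where M: "\<And>t. 0 \<le> t \<Longrightarrow> norm (signal_deriv w t) \<le> M"
    by (rule disturbance_deriv_bounded[OF w]) blast
  define k where "k = nat \<lfloor>t / \<tau>\<rfloor>"
  have k: "real k = of_int \<lfloor>t / \<tau>\<rfloor>" using t \<tau> by (simp add: k_def)
  have "real k \<le> t / \<tau>" "t / \<tau> < real k + 1"
    unfolding k by linarith+
  then have "t \<in> {real k * \<tau>..real (Suc k) * \<tau>}"
    using \<tau> by (simp add: field_simps)
  then have "norm (signal_deriv w t) \<le> norm (dist_seq \<tau> w k)"
    using dist_seq_bounds(1,2)[OF w \<tau> M] by fastforce
  also have "\<dots> \<le> seq_norm (dist_seq \<tau> w)"
    unfolding seq_norm_def using dist_seq_bounds(2,3)[OF w \<tau> M]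
    by (intro cSUP_upper bdd_aboveI[of _ M]) auto
  finally show ?thesis .
qed

lemma norm_sample_diff_le:
  assumes w: "disturbance Ws w" and \<tau>: "0 < \<tau>"
    and M: "\<And>t. 0 \<le> t \<Longrightarrow> norm (signal_deriv w t) \<le> M"
  shows "norm (sample \<tau> w (Suc k) - sample \<tau> w k) \<le> \<tau> * M"
proof -
  have "norm (sample \<tau> w (Suc k) - sample \<tau> w k) \<le> M * norm (real (Suc k) * \<tau> - real k * \<tau>)"
    unfolding sample_def
  proof (rule differentiable_bound[of "{0..}" w "\<lambda>t h. h *\<^sub>R signal_deriv w t"])
    show "(w has_derivative (\<lambda>h. h *\<^sub>R signal_deriv w t)) (at t within {0..})" if "t \<in> {0..}" for t
      using disturbance_has_vector_derivative[OF w] that by (simp add: has_vector_derivative_def)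
    show "onorm (\<lambda>h. h *\<^sub>R signal_deriv w t) \<le> M" if "t \<in> {0..}" for t
      using M that by (simp add: onorm_scaleR_left onorm_id)
  qed (use \<tau> in auto)
  also have "real (Suc k) * \<tau> - real k * \<tau> = \<tau>" by (simp add: algebra_simps)
  finally show ?thesis using \<tau> by (simp add: mult.commute)
qed

section \<open>Time shifts of disturbances, plant solutions and sampling steps\<close>

lemma signal_deriv_shift:
  assumes w: "disturbance Ws w" and "0 \<le> s" "0 \<le> t"
  shows "((\<lambda>t. w (t + s)) has_vector_derivative signal_deriv w (t + s)) (at t within {0..})"
    and "signal_deriv (\<lambda>t. w (t + s)) t = signal_deriv w (t + s)"
proof -
  have "(w has_vector_derivative signal_deriv w (t + s)) (at (t + s) within (\<lambda>t. t + s) ` {0..})"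
    using assms by (intro has_vector_derivative_within_subset[OF disturbance_has_vector_derivative[OF w]]) auto
  moreover have "((\<lambda>t. t + s) has_vector_derivative 1) (at t within {0..})"
    by (auto intro!: derivative_eq_intros)
  ultimately show *: "((\<lambda>t. w (t + s)) has_vector_derivative signal_deriv w (t + s)) (at t within {0..})"
    using vector_diff_chain_within[of "\<lambda>t. t + s" 1 t "{0..}" w] by (simp add: o_def)
  \<comment> \<open>\<open>vector_derivative\<close> is determined by a derivative only along a
    nontrivial filter; the endpoint \<open>t = 0\<close> is included.\<close>
  have "at t within {0..} \<noteq> bot"
    using assms(3) islimpt_subset[of t "{0..t + 1}" "{0..}"] by (simp add: trivial_limit_within islimpt_Icc)
  then show "signal_deriv (\<lambda>t. w (t + s)) t = signal_deriv w (t + s)"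
    unfolding signal_deriv_def[of "\<lambda>t. w (t + s)"] using * by (intro vector_derivative_within)
qed

lemma disturbance_shift:
  assumes w: "disturbance Ws w" and s: "0 \<le> s"
  shows "disturbance Ws (\<lambda>t. w (t + s))"
proof -
  note deriv = signal_deriv_shift[OF w s]
  have cont: "continuous_on {0..} (signal_deriv (\<lambda>t. w (t + s)))"
  proof (rule continuous_on_eq)
    show "continuous_on {0..} (\<lambda>t. signal_deriv w (t + s))"
      by (rule continuous_on_compose2[of "{0..}" "signal_deriv w"])
        (use w s in \<open>auto simp: disturbance_def intro!: continuous_intros\<close>)
  qed (simp add: deriv(2))
  obtain M where M: "\<And>t. 0 \<le> t \<Longrightarrow> norm (signal_deriv w t) \<le> M"
    by (rule disturbance_deriv_bounded[OF w]) blast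
  have "esssup (restrict_space lborel {0..}) (\<lambda>t. ereal (norm (signal_deriv (\<lambda>t. w (t + s)) t))) \<le> ereal M"
    using M s by (intro esssup_continuous_le continuous_on_norm cont) (auto simp: deriv(2))
  then show ?thesis
    using w s cont deriv(1) unfolding disturbance_def
    by (auto intro: differentiableI_vector le_less_trans)
qed

lemma plant_solution_shift:
  assumes "plant_solution f v w (a + s) (b + s) \<xi>"
  shows "plant_solution f v (\<lambda>t. w (t + s)) a b (\<lambda>t. \<xi> (t + s))"
  unfolding plant_solution_def
proof
  fix t assume t: "t \<in> {a..b}"
  have "(\<xi> has_vector_derivative f (\<xi> (t + s)) v (w (t + s))) (at (t + s) within (\<lambda>t. t + s) ` {a..b})"
    using assms t by (simp add: plant_solution_def)
  moreover have "((\<lambda>t. t + s) has_vector_derivative 1) (at t within {a..b})"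
    by (auto intro!: derivative_eq_intros)
  ultimately show "((\<lambda>t. \<xi> (t + s)) has_vector_derivative f (\<xi> (t + s)) v (w (t + s))) (at t within {a..b})"
    using vector_diff_chain_within[of "\<lambda>t. t + s" 1 t "{a..b}" \<xi>] by (simp add: o_def)
qed

text \<open>\<open>plant_step\<close> is a definite description, so it suffices to match the end
  values described on both sides, by translating solutions in both directions.\<close>

lemma plant_step_shift:
  "plant_step f \<tau> (\<lambda>t. w (t + real n * \<tau>)) k x v = plant_step f \<tau> w (n + k) x v"
proof -
  let ?s = "real n * \<tau>"
  have eq: "real (n + k) * \<tau> = real k * \<tau> + ?s" "real (Suc (n + k)) * \<tau> = real (Suc k) * \<tau> + ?s"
    by (auto simp: algebra_simps)
  have "(\<exists>\<xi>. plant_solution f v (\<lambda>t. w (t + ?s)) (real k * \<tau>) (real (Suc k) * \<tau>) \<xi>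
        \<and> \<xi> (real k * \<tau>) = x \<and> \<xi> (real (Suc k) * \<tau>) = x') \<longleftrightarrow>
      (\<exists>\<xi>. plant_solution f v w (real k * \<tau> + ?s) (real (Suc k) * \<tau> + ?s) \<xi>
        \<and> \<xi> (real k * \<tau> + ?s) = x \<and> \<xi> (real (Suc k) * \<tau> + ?s) = x')" (is "?L \<longleftrightarrow> ?R") for x'
  proof
    assume ?L
    then obtain \<xi> where \<xi>: "plant_solution f v (\<lambda>t. w (t + ?s)) (real k * \<tau>) (real (Suc k) * \<tau>) \<xi>"
      "\<xi> (real k * \<tau>) = x" "\<xi> (real (Suc k) * \<tau>) = x'" by blast
    have "plant_solution f v (\<lambda>t. w (t + - ?s + ?s)) (real k * \<tau> + ?s) (real (Suc k) * \<tau> + ?s) (\<lambda>t. \<xi> (t + - ?s))"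
      using \<xi>(1) by (intro plant_solution_shift[of f v "\<lambda>t. w (t + ?s)" _ "- ?s"]) (simp del: of_nat_Suc)
    with \<xi>(2,3) show ?R
      by (intro exI[of _ "\<lambda>t. \<xi> (t + - ?s)"]) (simp del: of_nat_Suc)
  next
    assume ?R
    then show ?L
      using plant_solution_shift[of f v w _ ?s] by fast
  qed
  then show ?thesis
    unfolding plant_step_def eq by simp
qed

section \<open>Causal versions of the estimates\<close>

text \<open>(P) is applied to the input that is frozen after time \<open>k\<close>.\<close>

lemma plant_estimate_causal:
  assumes est: "plant_estimate f Us Ws V \<epsilon>x \<epsilon>w \<tau> \<gamma>xu" and pos: "0 < \<tau>" "0 < \<epsilon>x" "0 < \<epsilon>w"
  obtains \<beta>x \<gamma>xd b0 d0 where "class_KL \<beta>x" "class_KL \<gamma>xd" "0 < b0" "0 < d0"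
    "\<And>w x u d B k. \<lbrakk>disturbance Ws w; range u \<subseteq> Us; \<And>j. x (Suc j) = plant_step f \<tau> w j (x j) (u j);
      \<And>t. 0 \<le> t \<Longrightarrow> norm (signal_deriv w t) \<le> d; V (x 0) (u 0) (sample \<tau> w 0) \<le> 0.25 * \<epsilon>x; d \<le> d0;
      0 \<le> B; B \<le> b0; \<And>j. j < k \<Longrightarrow> norm (u (Suc j) - u j) \<le> B\<rbrakk> \<Longrightarrow>
      V (x k) (u k) (sample \<tau> w k) \<le> \<beta>x (V (x 0) (u 0) (sample \<tau> w 0)) (real k * \<tau>) + \<gamma>xu \<tau> * B + \<gamma>xd d \<tau>"
proof -
  from est obtain \<beta>x \<gamma>xd \<pi>1 \<pi>2 where L: "class_L \<gamma>xu" and KL: "class_KL \<beta>x" "class_KL \<gamma>xd"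
    and \<pi>: "0 < \<pi>1" "class_K \<pi>2"
    and E: "\<forall>w x u. disturbance Ws w \<and> range u \<subseteq> Us \<and>
           (\<forall>k. x (Suc k) = plant_step f \<tau> w k (x k) (u k)) \<and>
           V (x 0) (u 0) (sample \<tau> w 0) \<le> 0.25 * \<epsilon>x \<and>
           seq_norm (\<lambda>k. u (Suc k) - u k) \<le> \<pi>1 * \<epsilon>x \<and>
           \<pi>2 (seq_norm (dist_seq \<tau> w)) \<le> \<epsilon>x \<and>
           seq_norm (dist_seq \<tau> w) \<le> \<epsilon>w \<longrightarrow>
           (\<forall>k. V (x k) (u k) (sample \<tau> w k) \<le>
                  \<beta>x (V (x 0) (u 0) (sample \<tau> w 0)) (real k * \<tau>)
                  + \<gamma>xu \<tau> * seq_norm (\<lambda>k. u (Suc k) - u k)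
                  + \<gamma>xd (seq_norm (dist_seq \<tau> w)) \<tau>)"
    unfolding plant_estimate_def by (elim exE conjE) (rule that; assumption)
  have "\<forall>\<^sub>F s in at_right 0. \<pi>2 s < \<epsilon>x"
    by (rule class_K_eventually_less[OF \<pi>(2) pos(2)])
  then have "\<forall>\<^sub>F s in at_right 0. 0 < s \<and> s < \<epsilon>w \<and> \<pi>2 s < \<epsilon>x"
    using eventually_at_right_real[OF pos(3)] by eventually_elim auto
  \<comment> \<open>Chosen so that \<open>d \<le> d0\<close> implies both disturbance premises of
    (P).\<close>
  then obtain d0 where d0: "0 < d0" "d0 < \<epsilon>w" "\<pi>2 d0 < \<epsilon>x"
    by (auto dest!: eventually_happens)
  show thesis
  proof (rule that[OF KL _ d0(1)])
    show "0 < \<pi>1 * \<epsilon>x" using \<pi> pos by simp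
  next
    fix w x u d B and k :: nat
    assume w: "disturbance Ws w" and u: "range u \<subseteq> Us" and x: "\<And>j. x (Suc j) = plant_step f \<tau> w j (x j) (u j)"
      and d: "\<And>t. 0 \<le> t \<Longrightarrow> norm (signal_deriv w t) \<le> d" "d \<le> d0"
      and V0: "V (x 0) (u 0) (sample \<tau> w 0) \<le> 0.25 * \<epsilon>x"
      and B: "0 \<le> B" "B \<le> \<pi>1 * \<epsilon>x" "\<And>j. j < k \<Longrightarrow> norm (u (Suc j) - u j) \<le> B"
    define u' where "u' j = u (min j k)" for j
    define x' where "x' = rec_nat (x 0) (\<lambda>j \<xi>. plant_step f \<tau> w j \<xi> (u' j))"
    have x'_eq: "x' j = x j" if "j \<le> k" for j
      using that by (induction j) (auto simp: x'_def u'_def x)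
    have u': "seq_norm (\<lambda>j. u' (Suc j) - u' j) \<le> B"
      unfolding seq_norm_def
    proof (rule cSUP_least)
      show "norm (u' (Suc j) - u' j) \<le> B" for j
        using B(1) B(3)[of j] by (cases "j < k") (auto simp: u'_def min_def not_less)
    qed auto
    let ?d = "seq_norm (dist_seq \<tau> w)"
    have d_le: "0 \<le> ?d" "?d \<le> d"
      using norm_signal_deriv_le[OF w pos(1), of 0] norm_ge_zero[of "signal_deriv w 0"]
        seq_norm_dist_seq_le[OF w pos(1) d(1)] by linarith+
    have "V (x' k) (u' k) (sample \<tau> w k) \<le> \<beta>x (V (x' 0) (u' 0) (sample \<tau> w 0)) (real k * \<tau>)
        + \<gamma>xu \<tau> * seq_norm (\<lambda>k. u' (Suc k) - u' k) + \<gamma>xd ?d \<tau>"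
    proof (rule E[rule_format], intro conjI allI w)
      show "range u' \<subseteq> Us" using u by (auto simp: u'_def)
      show "x' (Suc j) = plant_step f \<tau> w j (x' j) (u' j)" for j by (simp add: x'_def)
      show "V (x' 0) (u' 0) (sample \<tau> w 0) \<le> 0.25 * \<epsilon>x" using V0 by (simp add: x'_def u'_def)
      show "\<pi>2 ?d \<le> \<epsilon>x" using class_K_mono[OF \<pi>(2) d_le(1), of d0] d_le d d0 by linarith
    qed (use u' B d_le d d0 in linarith)+
    moreover have "\<gamma>xu \<tau> * seq_norm (\<lambda>k. u' (Suc k) - u' k) \<le> \<gamma>xu \<tau> * B"
      using class_L_pos[OF L, of \<tau>] pos(1) u' by (intro mult_left_mono) auto
    moreover have "\<gamma>xd ?d \<tau> \<le> \<gamma>xd d \<tau>"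
      using d_le pos(1) by (intro class_KL_mono[OF KL(2)]) auto
    ultimately show "V (x k) (u k) (sample \<tau> w k) \<le> \<beta>x (V (x 0) (u 0) (sample \<tau> w 0)) (real k * \<tau>) + \<gamma>xu \<tau> * B + \<gamma>xd d \<tau>"
      using x'_eq[of k] x'_eq[of 0] by (simp add: u'_def)
  qed
qed

text \<open>(A) is applied to the recursion driven by \<open>x j\<close> for \<open>j \<le> k\<close> and by the steady state \<open>p (u j) (w j)\<close>,
  where \<open>V\<close> vanishes, from then on.\<close>

lemma algorithm_estimate_causal:
  assumes est: "algorithm_estimate f g p q T Ws V W \<tau> \<epsilon>2 \<gamma>ux" and \<tau>: "0 < \<tau>" and q: "range q \<subseteq> Us"
    and V: "\<And>x v \<omega>. v \<in> Us \<Longrightarrow> \<omega> \<in> Ws \<Longrightarrow> 0 \<le> V x v \<omega>" "\<And>v \<omega>. v \<in> Us \<Longrightarrow> \<omega> \<in> Ws \<Longrightarrow> V (p v \<omega>) v \<omega> = 0"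
  obtains \<epsilon>1 \<epsilon>3 \<beta>z \<beta>u \<gamma>zx \<gamma>zd \<gamma>ud where "0 < \<epsilon>1" "0 < \<epsilon>3" "class_KL \<beta>z" "class_KL \<beta>u" "class_KL \<gamma>zx" "class_K \<gamma>zd" "class_K \<gamma>ud"
    "\<And>w x y z u d s k. \<lbrakk>disturbance Ws w; closed_loop f g q T \<tau> w x y z u;
      \<And>t. 0 \<le> t \<Longrightarrow> norm (signal_deriv w t) \<le> d; 0 \<le> W (z 0) (sample \<tau> w 0); W (z 0) (sample \<tau> w 0) \<le> \<epsilon>1; d \<le> \<epsilon>3;
      s \<le> \<epsilon>2; \<And>j. j \<le> k \<Longrightarrow> V (x j) (u j) (sample \<tau> w j) \<le> s\<rbrakk> \<Longrightarrow>
      W (z k) (sample \<tau> w k) \<le> \<beta>z (W (z 0) (sample \<tau> w 0)) (real k) + \<gamma>zx s \<tau> + \<gamma>zd d \<and>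
      norm (u (Suc k) - u k) \<le> \<beta>u (W (z 0) (sample \<tau> w 0)) (real k) + \<gamma>ux s \<tau> + \<gamma>ud d"
proof -
  from est obtain \<epsilon>1 \<epsilon>3 \<beta>z \<beta>u \<gamma>zx \<gamma>zd \<gamma>ud where pos: "0 < \<epsilon>1" "0 < \<epsilon>3"
    and KL: "class_KL \<gamma>ux" "class_KL \<beta>z" "class_KL \<beta>u" "class_KL \<gamma>zx" and K: "class_K \<gamma>zd" "class_K \<gamma>ud"
    and E: "\<forall>w x z u \<delta>x. disturbance Ws w \<and>
           (\<forall>k. z (Suc k) = T (z k) (g (plant_step f \<tau> w k (x k) (u k)) (sample \<tau> w (Suc k)))) \<and>
           (\<forall>k. u k = q (z k)) \<and>
           (\<forall>k. x k = p (u k) (sample \<tau> w k) + \<delta>x k) \<and>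
           0 \<le> W (z 0) (sample \<tau> w 0) \<and> W (z 0) (sample \<tau> w 0) \<le> \<epsilon>1 \<and>
           bdd_above (range (\<lambda>k. V (x k) (u k) (sample \<tau> w k))) \<and>
           (SUP k. V (x k) (u k) (sample \<tau> w k)) \<le> \<epsilon>2 \<and> seq_norm (dist_seq \<tau> w) \<le> \<epsilon>3 \<longrightarrow>
           (\<forall>k. W (z k) (sample \<tau> w k) \<le> \<beta>z (W (z 0) (sample \<tau> w 0)) (real k)
             + \<gamma>zx (SUP k. V (x k) (u k) (sample \<tau> w k)) \<tau> + \<gamma>zd (seq_norm (dist_seq \<tau> w)) \<and>
           norm (u (Suc k) - u k) \<le> \<beta>u (W (z 0) (sample \<tau> w 0)) (real k)
             + \<gamma>ux (SUP k. V (x k) (u k) (sample \<tau> w k)) \<tau> + \<gamma>ud (seq_norm (dist_seq \<tau> w)))"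
    unfolding algorithm_estimate_def Let_def by (elim exE conjE) (rule that; assumption)
  show thesis
  proof (rule that[OF pos KL(2-4) K])
    fix w x y z u d s and k :: nat
    assume w: "disturbance Ws w" and loop: "closed_loop f g q T \<tau> w x y z u"
      and d: "\<And>t. 0 \<le> t \<Longrightarrow> norm (signal_deriv w t) \<le> d" "d \<le> \<epsilon>3"
      and W0: "0 \<le> W (z 0) (sample \<tau> w 0)" "W (z 0) (sample \<tau> w 0) \<le> \<epsilon>1"
      and s: "s \<le> \<epsilon>2" "\<And>j. j \<le> k \<Longrightarrow> V (x j) (u j) (sample \<tau> w j) \<le> s"
    have ws: "sample \<tau> w j \<in> Ws" for j
      using w \<tau> by (simp add: disturbance_def sample_def)
    \<comment> \<open>The steady state after time \<open>k\<close> depends on the current iterate,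
      so the switch is a function of \<zeta> and is built into the recursion for \<open>z'\<close>.
      The modified states need not follow the plant: (A) admits any exogenous \<delta>x.\<close>
    define X where "X j \<zeta> = (if j \<le> k then x j else p (q \<zeta>) (sample \<tau> w j))" for j \<zeta>
    define z' where "z' = rec_nat (z 0) (\<lambda>j \<zeta>. T \<zeta> (g (plant_step f \<tau> w j (X j \<zeta>) (q \<zeta>)) (sample \<tau> w (Suc j))))"
    define u' where "u' j = q (z' j)" for j
    define x' where "x' j = X j (z' j)" for j
    \<comment> \<open>Agreement extends to \<open>Suc k\<close>, one step beyond the states, because
      \<open>z (Suc k)\<close> is computed from \<open>x k\<close>. The increment at
      \<open>k\<close> needs this last step.\<close>
    have z'_eq: "z' j = z j" if "j \<le> Suc k" for j
      using that
    proof (induction j)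
      case (Suc j)
      have "z' (Suc j) = T (z' j) (g (plant_step f \<tau> w j (X j (z' j)) (q (z' j))) (sample \<tau> w (Suc j)))"
        by (simp add: z'_def)
      also have "\<dots> = z (Suc j)"
        using Suc loop by (simp add: X_def closed_loop_def)
      finally show ?case .
    qed (simp add: z'_def)
    have u'_eq: "u' j = u j" if "j \<le> Suc k" for j
      using z'_eq[OF that] loop by (simp add: u'_def closed_loop_def)
    have u'_in: "u' j \<in> Us" for j using q by (auto simp: u'_def)
    let ?V = "\<lambda>j. V (x' j) (u' j) (sample \<tau> w j)"
    have V0: "0 \<le> ?V j" for j using V(1) u'_in ws by blast
    \<comment> \<open>Beyond time \<open>k\<close> the value of \<open>V\<close> is 0; it is below
      \<open>s\<close> because \<open>s\<close> already bounds the nonnegative value at time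
      0.\<close>
    have s0: "0 \<le> s"
      using s(2)[of 0] V0[of 0] u'_eq[of 0] by (simp add: x'_def X_def)
    have Vs: "?V j \<le> s" for j
    proof (cases "j \<le> k")
      case True
      then show ?thesis using s(2)[of j] u'_eq[of j] by (simp add: x'_def X_def)
    next
      case False
      then show ?thesis using V(2)[OF u'_in ws] s0 by (simp add: x'_def X_def u'_def)
    qed
    have bdd: "bdd_above (range ?V)" using Vs by (intro bdd_aboveI[of _ s]) auto
    have sup: "0 \<le> (SUP j. ?V j)" "(SUP j. ?V j) \<le> s"
      using cSUP_upper2[OF bdd, of 0 0] V0 Vs by (auto intro: cSUP_least)
    let ?d = "seq_norm (dist_seq \<tau> w)"
    have d_le: "0 \<le> ?d" "?d \<le> d"
      using norm_signal_deriv_le[OF w \<tau>, of 0] norm_ge_zero[of "signal_deriv w 0"]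
        seq_norm_dist_seq_le[OF w \<tau> d(1)] by linarith+
    have "W (z' k) (sample \<tau> w k) \<le> \<beta>z (W (z' 0) (sample \<tau> w 0)) (real k) + \<gamma>zx (SUP j. ?V j) \<tau> + \<gamma>zd ?d \<and>
        norm (u' (Suc k) - u' k) \<le> \<beta>u (W (z' 0) (sample \<tau> w 0)) (real k) + \<gamma>ux (SUP j. ?V j) \<tau> + \<gamma>ud ?d"
    proof (rule E[rule_format], intro conjI allI w)
      show "z' (Suc j) = T (z' j) (g (plant_step f \<tau> w j (x' j) (u' j)) (sample \<tau> w (Suc j)))" for j
        by (simp add: z'_def x'_def u'_def)
      show "x' j = p (u' j) (sample \<tau> w j) + (x' j - p (u' j) (sample \<tau> w j))" for j by simp
      show "u' j = q (z' j)" for j by (fact u'_def)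
      show "0 \<le> W (z' 0) (sample \<tau> w 0)" "W (z' 0) (sample \<tau> w 0) \<le> \<epsilon>1"
        using W0 z'_eq[of 0] by simp_all
      show "(SUP j. ?V j) \<le> \<epsilon>2" "?d \<le> \<epsilon>3"
        using sup s(1) d_le d(2) by linarith+
    qed (fact bdd)
    moreover have "\<gamma>zx (SUP j. ?V j) \<tau> \<le> \<gamma>zx s \<tau>" "\<gamma>ux (SUP j. ?V j) \<tau> \<le> \<gamma>ux s \<tau>"
      using class_KL_mono[OF KL(4) less_imp_le[OF \<tau>] sup] class_KL_mono[OF KL(1) less_imp_le[OF \<tau>] sup]
      by blast+
    moreover have "\<gamma>zd ?d \<le> \<gamma>zd d" "\<gamma>ud ?d \<le> \<gamma>ud d"
      using class_K_mono[OF K(1) d_le] class_K_mono[OF K(2) d_le] by blast+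
    ultimately show "W (z k) (sample \<tau> w k) \<le> \<beta>z (W (z 0) (sample \<tau> w 0)) (real k) + \<gamma>zx s \<tau> + \<gamma>zd d \<and>
        norm (u (Suc k) - u k) \<le> \<beta>u (W (z 0) (sample \<tau> w 0)) (real k) + \<gamma>ux s \<tau> + \<gamma>ud d"
      using z'_eq[of k] z'_eq[of 0] u'_eq[of k] u'_eq[of "Suc k"] by simp
  qed
qed

section \<open>Compactness and continuity of the steady-state map\<close>

lemma compact_uniform_radius:
  fixes S :: "'a::metric_space set"
  assumes S: "compact S" and loc: "\<And>a. a \<in> S \<Longrightarrow> \<exists>\<delta>>0. \<forall>x\<in>S. dist x a < \<delta> \<longrightarrow> P \<delta> x"
    and mono: "\<And>\<delta> \<delta>' x. P \<delta> x \<Longrightarrow> \<delta>' \<le> \<delta> \<Longrightarrow> P \<delta>' x"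
  shows "\<exists>\<delta>>0. \<forall>x\<in>S. P (\<delta>::real) x"
proof -
  obtain r where r: "\<And>a. a \<in> S \<Longrightarrow> 0 < r a" "\<And>a x. a \<in> S \<Longrightarrow> x \<in> S \<Longrightarrow> dist x a < r a \<Longrightarrow> P (r a) x"
    using loc by metis
  have "S \<subseteq> (\<Union>a\<in>S. ball a (r a))" using r(1) by force
  then obtain C where C: "C \<subseteq> S" "finite C" "S \<subseteq> (\<Union>a\<in>C. ball a (r a))"
    using compactE_image[OF S, of S "\<lambda>a. ball a (r a)"] by auto
  define \<delta> where "\<delta> = Min (insert 1 (r ` C))"
  have "0 < \<delta>" using C r(1) by (auto simp: \<delta>_def)
  moreover have "P \<delta> x" if x: "x \<in> S" for x
  proof -
    obtain a where a: "a \<in> C" "dist x a < r a"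
      using C(3) x by (auto simp: dist_commute)
    then have "P (r a) x" using r(2) C(1) x by blast
    moreover have "\<delta> \<le> r a" using a C(2) by (simp add: \<delta>_def)
    ultimately show ?thesis by (rule mono)
  qed
  ultimately show ?thesis by blast
qed

lemma C1_on_imp_continuous_on: "C1_on D F \<Longrightarrow> continuous_on D F"
  unfolding C1_on_def continuous_on_eq_continuous_within using has_derivative_continuous by blast

text \<open>The quadratic lower bound makes \<open>p\<close> inherit the continuity of \<open>V\<close>: \<open>|p v0 w0 - p v w|\<^sup>2\<close> is at most
  a multiple of \<open>V (p v0 w0) v w\<close>, which vanishes at \<open>(v0, w0)\<close>.\<close>

lemma steady_state_continuous:
  assumes C1: "C1_on (UNIV \<times> Us \<times> Ws) (\<lambda>(x, v, \<omega>). V x v \<omega>)" and "0 < \<alpha>3"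
    and lower: "\<And>x v \<omega>. v \<in> Us \<Longrightarrow> \<omega> \<in> Ws \<Longrightarrow> \<alpha>3 * (norm (x - p v \<omega>))\<^sup>2 \<le> V x v \<omega>"
    and zero: "\<And>v \<omega>. v \<in> Us \<Longrightarrow> \<omega> \<in> Ws \<Longrightarrow> V (p v \<omega>) v \<omega> = 0"
  shows "continuous_on (Us \<times> Ws) (\<lambda>(v, \<omega>). p v \<omega>)"
  unfolding continuous_on_def
proof
  fix a assume a: "a \<in> Us \<times> Ws"
  define x0 where "x0 = p (fst a) (snd a)"
  let ?h = "\<lambda>b. V x0 (fst b) (snd b)"
  have cont: "continuous_on (Us \<times> Ws) (\<lambda>b. (\<lambda>(x, v, \<omega>). V x v \<omega>) (x0, fst b, snd b))"
    by (rule continuous_on_compose2[OF C1_on_imp_continuous_on[OF C1]]) (auto intro!: continuous_intros)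
  have "(?h \<longlongrightarrow> ?h a) (at a within Us \<times> Ws)"
    using cont[unfolded prod.case] a unfolding continuous_on_def by blast
  moreover have "?h a = 0" using a zero by (auto simp: x0_def)
  ultimately have lim: "((\<lambda>b. sqrt (?h b / \<alpha>3)) \<longlongrightarrow> sqrt (0 / \<alpha>3)) (at a within Us \<times> Ws)"
    by (intro tendsto_intros) (use assms(2) in auto)
  have "\<forall>\<^sub>F b in at a within Us \<times> Ws. norm (p (fst b) (snd b) - x0) \<le> sqrt (?h b / \<alpha>3)"
    unfolding eventually_at_filter
  proof (intro always_eventually allI impI)
    fix b assume "b \<in> Us \<times> Ws"
    then have "\<alpha>3 * (norm (x0 - p (fst b) (snd b)))\<^sup>2 \<le> ?h b" by (intro lower) auto
    then show "norm (p (fst b) (snd b) - x0) \<le> sqrt (?h b / \<alpha>3)"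
      using assms(2) by (intro real_le_rsqrt) (simp add: field_simps norm_minus_commute)
  qed
  then have "((\<lambda>b. p (fst b) (snd b) - x0) \<longlongrightarrow> 0) (at a within Us \<times> Ws)"
    by (rule Lim_null_comparison) (rule lim[unfolded div_0 real_sqrt_zero])
  then show "((\<lambda>(v, \<omega>). p v \<omega>) \<longlongrightarrow> (case a of (v, \<omega>) \<Rightarrow> p v \<omega>)) (at a within Us \<times> Ws)"
    unfolding case_prod_beta x0_def[symmetric] by (rule LIM_zero_cancel)
qed

section \<open>Invariance of a neighbourhood of the branch\<close>

text \<open>Pointwise continuity at the branch is uniform in \<open>\<omega>\<close>: by the Lipschitz bound on \<open>T\<close> the reduced map
  depends on \<open>\<omega>\<close> uniformly continuously, uniformly in \<open>z\<close>, and \<open>Ws\<close> is compact.\<close>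

lemma reduced_map_uniform_at_branch:
  fixes Us :: "'u::metric_space set" and Ws :: "'w::metric_space set"
  assumes Ws: "compact Ws" and q: "range q \<subseteq> Us"
    and h: "uniformly_continuous_on (Us \<times> Ws) (\<lambda>(v, \<omega>). ss_output g p v \<omega>)"
    and L: "0 < L" "\<And>z s s'. norm (T z s - T z s') \<le> L * norm (s - s')"
    and zb: "continuous_on Ws zb"
    and fp: "\<And>\<omega>. \<omega> \<in> Ws \<Longrightarrow> reduced_map T g p q (zb \<omega>) \<omega> = zb \<omega>"
    and cont: "\<And>\<omega>. \<omega> \<in> Ws \<Longrightarrow> isCont (\<lambda>z. reduced_map T g p q z \<omega>) (zb \<omega>)"
    and e: "0 < e"
  shows "\<exists>\<delta>>0. \<forall>\<omega>\<in>Ws. \<forall>z. norm (z - zb \<omega>) < \<delta> \<longrightarrow> norm (reduced_map T g p q z \<omega> - zb \<omega>) \<le> e"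
proof (rule compact_uniform_radius[OF Ws])
  \<comment> \<open>Three errors of size \<open>e / 3\<close> are allowed: replacing \<omega> by
    \<open>a\<close> in the reduced map, continuity of the reduced map at \<open>zb a\<close>, and
    variation of \<open>zb\<close>. The first must be small for all \<open>z\<close> at once, hence
    the uniform continuity of the steady-state output.\<close>
  fix a assume a: "a \<in> Ws"
  obtain r where r: "0 < r" "\<And>z. dist z (zb a) < r \<Longrightarrow> dist (reduced_map T g p q z a) (zb a) < e / 3"
    using cont[OF a] e fp[OF a] unfolding continuous_at_eps_delta by (metis divide_pos_pos zero_less_numeral)
  have "0 < e / (3 * L)" using e L by simp
  then obtain d1 where d1: "0 < d1" "\<And>b b'. b \<in> Us \<times> Ws \<Longrightarrow> b' \<in> Us \<times> Ws \<Longrightarrow> dist b' b < d1 \<Longrightarrow>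
      dist (case b' of (v, \<omega>) \<Rightarrow> ss_output g p v \<omega>) (case b of (v, \<omega>) \<Rightarrow> ss_output g p v \<omega>) < e / (3 * L)"
    using h unfolding uniformly_continuous_on_def by metis
  have "0 < min (r / 2) (e / 3)" using r e by simp
  then obtain d2 where d2: "0 < d2" "\<And>\<omega>. \<omega> \<in> Ws \<Longrightarrow> dist \<omega> a < d2 \<Longrightarrow> dist (zb \<omega>) (zb a) < min (r / 2) (e / 3)"
    using zb a unfolding continuous_on_iff by meson
  define \<delta> where "\<delta> = Min {r / 2, d1, d2}"
  have \<delta>: "0 < \<delta>" "\<delta> \<le> r / 2" "\<delta> \<le> d1" "\<delta> \<le> d2" using r d1 d2 by (auto simp: \<delta>_def)
  have "norm (reduced_map T g p q z \<omega> - zb \<omega>) \<le> e"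
    if \<omega>: "\<omega> \<in> Ws" "dist \<omega> a < \<delta>" and z: "norm (z - zb \<omega>) < \<delta>" for \<omega> z
  proof -
    have zba: "dist (zb \<omega>) (zb a) < r / 2" "dist (zb \<omega>) (zb a) < e / 3"
      using d2(2)[OF \<omega>(1)] \<omega>(2) \<delta> by auto
    have "dist z (zb a) < r"
      using dist_triangle[of z "zb a" "zb \<omega>"] z \<delta>(2) zba(1) by (simp add: dist_norm)
    then have 1: "dist (reduced_map T g p q z a) (zb a) < e / 3" by (rule r(2))
    have "dist (ss_output g p (q z) \<omega>) (ss_output g p (q z) a) < e / (3 * L)"
      using d1(2)[of "(q z, a)" "(q z, \<omega>)"] q a \<omega> \<delta> by (auto simp: dist_Pair_Pair)
    then have "L * norm (ss_output g p (q z) \<omega> - ss_output g p (q z) a) \<le> L * (e / (3 * L))"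
      using L(1) by (intro mult_left_mono) (auto simp: dist_norm)
    also have "\<dots> = e / 3" using L(1) by simp
    finally have 2: "dist (reduced_map T g p q z \<omega>) (reduced_map T g p q z a) \<le> e / 3"
      using L(2) unfolding reduced_map_def dist_norm by (rule order_trans[rotated])
    have "dist (reduced_map T g p q z \<omega>) (zb \<omega>) \<le> e"
      using 1 2 zba(2) dist_triangle[of "reduced_map T g p q z \<omega>" "zb \<omega>" "reduced_map T g p q z a"]
        dist_triangle[of "reduced_map T g p q z a" "zb \<omega>" "zb a"] by (simp add: dist_commute)
    then show ?thesis by (simp add: dist_norm)
  qed
  with \<delta>(1) show "\<exists>\<delta>>0. \<forall>\<omega>\<in>Ws. dist \<omega> a < \<delta> \<longrightarrow>
      (\<forall>z. norm (z - zb \<omega>) < \<delta> \<longrightarrow> norm (reduced_map T g p q z \<omega> - zb \<omega>) \<le> e)"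
    by blast
qed auto

text \<open>A small \<open>V\<close> at the new sample, a small input increment and a slow
  disturbance put the output at \<open>Suc k\<close> close to the steady-state output for the input
  and disturbance at \<open>k\<close>. By the Lipschitz bound on \<open>T\<close>, the new iterate
  is close to the reduced map at \<open>z k\<close>, which is close to the branch by continuity.
  This supplies the assumption \<open>near\<close> of \<open>small_gain_loop\<close>.\<close>

lemma closed_loop_stays_near_branch:
  assumes Us: "compact Us" and Ws: "compact Ws" and q: "range q \<subseteq> Us" and \<tau>: "0 < \<tau>"
    and p: "continuous_on (Us \<times> Ws) (\<lambda>(v, \<omega>). p v \<omega>)"
    and g: "Lg-lipschitz_on (UNIV \<times> Ws) (\<lambda>(x, \<omega>). g x \<omega>)"
    and L: "0 < L" "\<And>z s s'. norm (T z s - T z s') \<le> L * norm (s - s')"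
    and zb: "Lz-lipschitz_on Ws zb"
    and fp: "\<And>\<omega>. \<omega> \<in> Ws \<Longrightarrow> reduced_map T g p q (zb \<omega>) \<omega> = zb \<omega>"
    and cont: "\<And>\<omega>. \<omega> \<in> Ws \<Longrightarrow> isCont (\<lambda>z. reduced_map T g p q z \<omega>) (zb \<omega>)"
    and \<alpha>3: "0 < \<alpha>3" "\<And>x v \<omega>. v \<in> Us \<Longrightarrow> \<omega> \<in> Ws \<Longrightarrow> \<alpha>3 * (norm (x - p v \<omega>))\<^sup>2 \<le> V x v \<omega>"
    and e: "0 < e"
  shows "\<exists>\<mu>>0. \<forall>w x y z u d k. disturbance Ws w \<and> closed_loop f g q T \<tau> w x y z u \<and>
      (\<forall>t\<ge>0. norm (signal_deriv w t) \<le> d) \<and> norm (z k - zb (sample \<tau> w k)) \<le> \<mu> \<and>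
      norm (u (Suc k) - u k) \<le> \<mu> \<and> V (x (Suc k)) (u (Suc k)) (sample \<tau> w (Suc k)) \<le> \<mu> \<and> d \<le> \<mu> \<longrightarrow>
      norm (z (Suc k) - zb (sample \<tau> w (Suc k))) \<le> e"
proof -
  have Lg: "0 \<le> Lg" and Lz: "0 \<le> Lz"
    using g zb by (auto dest: lipschitz_on_nonneg)
  have comp: "compact (Us \<times> Ws)" using Us Ws by (rule compact_Times)
  have p_unif: "uniformly_continuous_on (Us \<times> Ws) (\<lambda>(v, \<omega>). p v \<omega>)"
    by (rule compact_uniformly_continuous[OF p comp])
  have "continuous_on (Us \<times> Ws) (\<lambda>b. (\<lambda>(x, \<omega>). g x \<omega>) ((\<lambda>(v, \<omega>). p v \<omega>) b, snd b))"
    by (rule continuous_on_compose2[OF lipschitz_on_continuous_on[OF g]])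
      (auto intro!: continuous_on_Pair p continuous_on_snd continuous_on_id)
  then have "uniformly_continuous_on (Us \<times> Ws) (\<lambda>b. (\<lambda>(x, \<omega>). g x \<omega>) ((\<lambda>(v, \<omega>). p v \<omega>) b, snd b))"
    by (rule compact_uniformly_continuous[OF _ comp])
  then have h_unif: "uniformly_continuous_on (Us \<times> Ws) (\<lambda>(v, \<omega>). ss_output g p v \<omega>)"
    by (simp add: ss_output_def case_prod_unfold)
  have e3: "0 < e / 3" using e by simp
  obtain \<delta>r where \<delta>r: "0 < \<delta>r" "\<And>\<omega> z. \<omega> \<in> Ws \<Longrightarrow> norm (z - zb \<omega>) < \<delta>r \<Longrightarrow> norm (reduced_map T g p q z \<omega> - zb \<omega>) \<le> e / 3"
    using reduced_map_uniform_at_branch[OF Ws q h_unif L lipschitz_on_continuous_on[OF zb] fp cont e3] by blast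
  \<comment> \<open>\<open>3 * a\<close> is the deviation allowed in the arguments of
    \<open>g\<close>: distance of the state from its steady state, movement of the steady state, and
    movement of \<open>w\<close>, each at most \<open>a\<close>. The added 1 keeps the denominator
    positive when \<open>Lg = 0\<close>.\<close>
  define a where "a = e / (9 * (L * Lg + 1))"
  have LLg: "0 \<le> L * Lg" using L(1) Lg by simp
  have a: "0 < a" "L * (Lg * (3 * a)) \<le> e / 3"
  proof -
    show "0 < a" using e LLg by (simp add: a_def)
    have "(L * Lg + 1) * a = e / 9"
      using LLg by (simp add: a_def field_simps add_nonneg_eq_0_iff)
    with \<open>0 < a\<close> show "L * (Lg * (3 * a)) \<le> e / 3"
      by (simp add: algebra_simps)
  qed
  obtain \<delta>p where \<delta>p: "0 < \<delta>p" "\<And>b b'. b \<in> Us \<times> Ws \<Longrightarrow> b' \<in> Us \<times> Ws \<Longrightarrow> dist b' b < \<delta>p \<Longrightarrow>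
      dist (case b' of (v, \<omega>) \<Rightarrow> p v \<omega>) (case b of (v, \<omega>) \<Rightarrow> p v \<omega>) < a"
    using p_unif a(1) unfolding uniformly_continuous_on_def by metis
  \<comment> \<open>One entry per requirement: the continuity radius at the branch, the passage from
    \<open>V\<close> to the distance from the steady state, the joint displacement
    \<open>\<mu> + \<tau> * \<mu>\<close> of input and disturbance, the displacement of
    \<open>w\<close>, and that of \<open>zb\<close> along \<open>w\<close>.\<close>
  define \<mu> where "\<mu> = Min {\<delta>r / 2, \<alpha>3 * a\<^sup>2, \<delta>p / (2 * (1 + \<tau>)), a / \<tau>, e / (3 * (Lz + 1) * \<tau>)}"
  have "0 < \<mu>"
    using \<delta>r \<alpha>3 a \<delta>p \<tau> e Lz by (auto simp: \<mu>_def)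
  have \<mu>: "\<mu> \<le> \<delta>r / 2" "\<mu> \<le> \<alpha>3 * a\<^sup>2" "\<mu> \<le> \<delta>p / (2 * (1 + \<tau>))" "\<mu> \<le> a / \<tau>" "\<mu> \<le> e / (3 * (Lz + 1) * \<tau>)"
    unfolding \<mu>_def by (rule Min_le; simp)+
  have "norm (z (Suc k) - zb (sample \<tau> w (Suc k))) \<le> e"
    if w: "disturbance Ws w" and loop: "closed_loop f g q T \<tau> w x y z u"
      and d: "\<And>t. 0 \<le> t \<Longrightarrow> norm (signal_deriv w t) \<le> d" and zk: "norm (z k - zb (sample \<tau> w k)) \<le> \<mu>"
      and uk: "norm (u (Suc k) - u k) \<le> \<mu>" and Vk: "V (x (Suc k)) (u (Suc k)) (sample \<tau> w (Suc k)) \<le> \<mu>" and d\<mu>: "d \<le> \<mu>"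
    for w x y z u d k
  proof -
    let ?w = "sample \<tau> w k" and ?w' = "sample \<tau> w (Suc k)"
    have ws: "sample \<tau> w j \<in> Ws" for j
      using w \<tau> by (simp add: disturbance_def sample_def)
    have us: "u j \<in> Us" and uq: "u j = q (z j)" for j
      using loop q by (auto simp: closed_loop_def)
    have \<tau>\<mu>: "\<tau> * \<mu> \<le> a" "Lz * (\<tau> * \<mu>) \<le> e / 3" "\<mu> + \<tau> * \<mu> < \<delta>p"
    proof -
      show "\<tau> * \<mu> \<le> a" using \<mu>(4) \<tau> by (simp add: field_simps)
      have "0 < 3 * (Lz + 1) * \<tau>" using \<tau> Lz by simp
      then have "(Lz + 1) * (\<tau> * \<mu>) \<le> e / 3"
        using \<mu>(5) by (simp add: pos_le_divide_eq algebra_simps)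
      moreover have "Lz * (\<tau> * \<mu>) \<le> (Lz + 1) * (\<tau> * \<mu>)"
        using \<tau> \<open>0 < \<mu>\<close> by (intro mult_right_mono) auto
      ultimately show "Lz * (\<tau> * \<mu>) \<le> e / 3" by linarith
      have "(1 + \<tau>) * \<mu> \<le> \<delta>p / 2" using \<mu>(3) \<tau> by (simp add: field_simps)
      then show "\<mu> + \<tau> * \<mu> < \<delta>p" using \<delta>p(1) by (simp add: distrib_right)
    qed
    have "norm (?w' - ?w) \<le> \<tau> * d" by (rule norm_sample_diff_le[OF w \<tau> d])
    also have "\<dots> \<le> \<tau> * \<mu>" using \<tau> d\<mu> by (intro mult_left_mono) auto
    finally have dw: "norm (?w' - ?w) \<le> \<tau> * \<mu>" .
    have "\<alpha>3 * (norm (x (Suc k) - p (u (Suc k)) ?w'))\<^sup>2 \<le> \<alpha>3 * a\<^sup>2"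
      using \<alpha>3(2)[OF us ws] Vk \<mu>(2) by (meson order_trans)
    then have 1: "norm (x (Suc k) - p (u (Suc k)) ?w') \<le> a"
      using \<alpha>3(1) a(1) by (auto intro: power2_le_imp_le)
    have "dist (u (Suc k), ?w') (u k, ?w) \<le> norm (u (Suc k) - u k) + norm (?w' - ?w)"
      by (simp add: dist_norm norm_Pair_le)
    then have "dist (u (Suc k), ?w') (u k, ?w) < \<delta>p"
      using uk dw \<tau>\<mu>(3) by linarith
    then have 2: "norm (p (u (Suc k)) ?w' - p (u k) ?w) < a"
      using \<delta>p(2)[of "(u k, ?w)" "(u (Suc k), ?w')"] us ws by (simp add: dist_norm)
    have "norm (g (x (Suc k)) ?w' - g (p (u k) ?w) ?w) \<le> Lg * dist (x (Suc k), ?w') (p (u k) ?w, ?w)"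
      using lipschitz_onD[OF g, of "(x (Suc k), ?w')" "(p (u k) ?w, ?w)"] ws by (simp add: dist_norm)
    also have "\<dots> \<le> Lg * (3 * a)"
    proof (rule mult_left_mono[OF _ Lg])
      have "dist (x (Suc k), ?w') (p (u k) ?w, ?w) \<le> norm (x (Suc k) - p (u k) ?w) + norm (?w' - ?w)"
        by (simp add: dist_norm norm_Pair_le)
      also have "\<dots> \<le> norm (x (Suc k) - p (u (Suc k)) ?w') + norm (p (u (Suc k)) ?w' - p (u k) ?w) + norm (?w' - ?w)"
        using norm_triangle_ineq[of "x (Suc k) - p (u (Suc k)) ?w'" "p (u (Suc k)) ?w' - p (u k) ?w"] by simp
      finally show "dist (x (Suc k), ?w') (p (u k) ?w, ?w) \<le> 3 * a"
        using 1 2 dw \<tau>\<mu>(1) by linarith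
    qed
    finally have "L * norm (g (x (Suc k)) ?w' - g (p (u k) ?w) ?w) \<le> L * (Lg * (3 * a))"
      using L(1) by (intro mult_left_mono) auto
    moreover have "z (Suc k) = T (z k) (g (x (Suc k)) ?w')"
      using loop by (simp add: closed_loop_def)
    moreover have "reduced_map T g p q (z k) ?w = T (z k) (g (p (u k) ?w) ?w)"
      by (simp add: reduced_map_def ss_output_def uq)
    ultimately have 3: "norm (z (Suc k) - reduced_map T g p q (z k) ?w) \<le> e / 3"
      using L(2)[of "z k" "g (x (Suc k)) ?w'" "g (p (u k) ?w) ?w"] a(2) by simp
    have 4: "norm (reduced_map T g p q (z k) ?w - zb ?w) \<le> e / 3"
      using zk \<mu>(1) \<delta>r(1) by (intro \<delta>r(2)[OF ws]) simp
    have "norm (zb ?w' - zb ?w) \<le> Lz * norm (?w' - ?w)"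
      using lipschitz_onD[OF zb ws ws] by (simp add: dist_norm)
    also have "\<dots> \<le> Lz * (\<tau> * \<mu>)" using dw Lz by (rule mult_left_mono)
    finally have 5: "norm (zb ?w' - zb ?w) \<le> e / 3" using \<tau>\<mu>(2) by linarith
    have "norm (z (Suc k) - zb ?w') = norm ((z (Suc k) - reduced_map T g p q (z k) ?w)
        + (reduced_map T g p q (z k) ?w - zb ?w) - (zb ?w' - zb ?w))" by simp
    also have "\<dots> \<le> norm (z (Suc k) - reduced_map T g p q (z k) ?w)
        + norm (reduced_map T g p q (z k) ?w - zb ?w) + norm (zb ?w' - zb ?w)"
      by (meson add_right_mono norm_triangle_ineq norm_triangle_ineq4 order_trans)
    finally show ?thesis using 3 4 5 by linarith
  qed
  with \<open>0 < \<mu>\<close> show ?thesis by blast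
qed

section \<open>The closed loop\<close>

theorem theorem4:
  fixes f :: "'x::euclidean_space \<Rightarrow> 'u::euclidean_space \<Rightarrow> 'w::euclidean_space \<Rightarrow> 'x"
    and g :: "'x \<Rightarrow> 'w \<Rightarrow> 'y::euclidean_space"
    and p :: "'u \<Rightarrow> 'w \<Rightarrow> 'x"
    and q :: "'z::euclidean_space \<Rightarrow> 'u"
    and G :: "'z \<Rightarrow> 'y \<Rightarrow> 'z"
    and A :: "'z \<Rightarrow> 'z set"
    and T :: "'z \<Rightarrow> 'y \<Rightarrow> 'z"
    and Us :: "'u set" and Ws :: "'w set"
    and V :: "'x \<Rightarrow> 'u \<Rightarrow> 'w \<Rightarrow> real" and W :: "'z \<Rightarrow> 'w \<Rightarrow> real"
    and zb :: "'w \<Rightarrow> 'z"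
    and \<gamma>xu :: "real \<Rightarrow> real" and \<gamma>ux :: "real \<Rightarrow> real \<Rightarrow> real"
    and \<tau> \<epsilon>x \<epsilon>w \<epsilon>2 :: real
  assumes steady: "steady_state_map f Us Ws p"
    and q_range: "range q \<subseteq> Us"
    and plant: "plant_assumptions f g p Us Ws V \<epsilon>x \<epsilon>w"
    and equation: "equation_assumptions G A g p q Ws"
    and algorithm: "algorithm_assumptions T G A g p q Ws W"
    and period: "\<tau> > 0"
    and branch: "branch G A g p q Ws zb"
    and regular: "\<forall>\<omega>\<in>Ws. isCont (\<lambda>z. reduced_map T g p q z \<omega>) (zb \<omega>)"
    and plant_est: "plant_estimate f Us Ws V \<epsilon>x \<epsilon>w \<tau> \<gamma>xu"
    and algorithm_est: "algorithm_estimate f g p q T Ws V W \<tau> \<epsilon>2 \<gamma>ux"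
    and small_gain: "\<forall>s. 0 < s \<and> s \<le> min (0.25 * \<epsilon>x) \<epsilon>2 \<longrightarrow> \<gamma>xu \<tau> * \<gamma>ux s \<tau> < s"
  shows "\<exists>\<epsilon>>0. \<exists>\<beta> \<gamma>. class_KL \<beta> \<and> class_K \<gamma> \<and>
    (\<forall>w x y z u \<delta>x e.
       disturbance Ws w \<and> closed_loop f g q T \<tau> w x y z u \<and>
       (\<forall>k. \<delta>x k = x k - p (u k) (sample \<tau> w k)) \<and>
       (\<forall>k. e k = z k - zb (sample \<tau> w k)) \<and>
       norm (\<delta>x 0, e 0) \<le> \<epsilon> \<and> seq_norm (dist_seq \<tau> w) \<le> \<epsilon> \<longrightarrow>
       (\<forall>k. norm (\<delta>x k, e k) \<le> \<beta> (norm (\<delta>x 0, e 0)) (real k) + \<gamma> (seq_norm (dist_seq \<tau> w))))"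
proof -
  obtain Lg where Lg: "Lg-lipschitz_on (UNIV \<times> Ws) (\<lambda>(x, \<omega>). g x \<omega>)"
    and Us: "compact Us" and Ws: "compact Ws" and lyap: "plant_lyapunov f p Us Ws V \<epsilon>x \<epsilon>w"
    using plant unfolding plant_assumptions_def by blast
  from lyap obtain \<alpha>3 \<alpha>4 where \<epsilon>xw: "0 < \<epsilon>x" "0 < \<epsilon>w" and \<alpha>: "0 < \<alpha>3" "0 < \<alpha>4"
    and C1: "C1_on (UNIV \<times> Us \<times> Ws) (\<lambda>(x, v, \<omega>). V x v \<omega>)"
    and V_bounds: "\<forall>x. \<forall>v\<in>Us. \<forall>\<omega>\<in>Ws. \<alpha>3 * (norm (x - p v \<omega>))\<^sup>2 \<le> V x v \<omega> \<and>
             V x v \<omega> \<le> \<alpha>4 * (norm (x - p v \<omega>))\<^sup>2"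
    unfolding plant_lyapunov_def by (elim exE conjE) (rule that; assumption)
  have lower: "\<alpha>3 * (norm (x - p v \<omega>))\<^sup>2 \<le> V x v \<omega>" and upper: "V x v \<omega> \<le> \<alpha>4 * (norm (x - p v \<omega>))\<^sup>2"
    if "v \<in> Us" "\<omega> \<in> Ws" for x v \<omega>
    using V_bounds that by blast+
  have V_nonneg: "0 \<le> V x v \<omega>" if "v \<in> Us" "\<omega> \<in> Ws" for x v \<omega>
  proof (rule order_trans)
    show "0 \<le> \<alpha>3 * (norm (x - p v \<omega>))\<^sup>2" using \<alpha>(1) by simp
  qed (rule lower[OF that])
  have V_zero: "V (p v \<omega>) v \<omega> = 0" if "v \<in> Us" "\<omega> \<in> Ws" for v \<omega>
    using upper[OF that, of "p v \<omega>"] V_nonneg[OF that, of "p v \<omega>"] by simp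
  have p_cont: "continuous_on (Us \<times> Ws) (\<lambda>(v, \<omega>). p v \<omega>)"
    by (rule steady_state_continuous[OF C1 \<alpha>(1) lower V_zero])
  from algorithm obtain \<epsilon>z \<alpha>1 \<alpha>2 \<alpha>' L
    where fixed_points: "\<forall>\<omega>\<in>Ws. \<forall>z. z = reduced_map T g p q z \<omega> \<longleftrightarrow> z \<in> solution_map G A g p q \<omega>"
    and \<epsilon>z: "0 < \<epsilon>z" and Kinf: "class_K_inf \<alpha>1" "class_K_inf \<alpha>2"
    and W: "\<forall>\<omega>\<in>Ws. \<forall>zs\<in>solution_map G A g p q \<omega>. \<forall>z. norm (z - zs) \<le> \<epsilon>z \<longrightarrow>
           \<alpha>1 (norm (z - zs)) \<le> W z \<omega> \<and> W z \<omega> \<le> \<alpha>2 (norm (z - zs)) \<and>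
           W (reduced_map T g p q z \<omega>) \<omega> \<le> W z \<omega> - \<alpha>' (norm (z - zs))"
    and L: "0 < L" "\<forall>z s s'. norm (T z s - T z s') \<le> L * norm (s - s')"
    unfolding algorithm_assumptions_def by (elim exE conjE) (rule that; assumption)
  obtain Lz where Lz: "Lz-lipschitz_on Ws zb" and zb: "\<And>\<omega>. \<omega> \<in> Ws \<Longrightarrow> zb \<omega> \<in> solution_map G A g p q \<omega>"
    using branch unfolding branch_def by blast
  have fp: "reduced_map T g p q (zb \<omega>) \<omega> = zb \<omega>" if "\<omega> \<in> Ws" for \<omega>
    using fixed_points zb[OF that] that by metis
  obtain \<mu> where \<mu>: "0 < \<mu>"
    and near: "\<And>w x y z u d k. \<lbrakk>disturbance Ws w; closed_loop f g q T \<tau> w x y z u;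
      \<forall>t\<ge>0. norm (signal_deriv w t) \<le> d; norm (z k - zb (sample \<tau> w k)) \<le> \<mu>;
      norm (u (Suc k) - u k) \<le> \<mu>; V (x (Suc k)) (u (Suc k)) (sample \<tau> w (Suc k)) \<le> \<mu>; d \<le> \<mu>\<rbrakk> \<Longrightarrow>
      norm (z (Suc k) - zb (sample \<tau> w (Suc k))) \<le> \<epsilon>z"
    using closed_loop_stays_near_branch[OF Us Ws q_range period p_cont Lg L(1) _ Lz fp _ \<alpha>(1) lower \<epsilon>z, where f = f]
      L(2) regular by metis
  obtain \<beta>x \<gamma>xd b0 d0
    where KLx: "class_KL \<beta>x" "class_KL \<gamma>xd" and bd: "0 < b0" "0 < d0"
    and plant_bound: "\<And>w x u d B k. \<lbrakk>disturbance Ws w; range u \<subseteq> Us; \<And>j. x (Suc j) = plant_step f \<tau> w j (x j) (u j);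
      \<And>t. 0 \<le> t \<Longrightarrow> norm (signal_deriv w t) \<le> d; V (x 0) (u 0) (sample \<tau> w 0) \<le> 0.25 * \<epsilon>x; d \<le> d0;
      0 \<le> B; B \<le> b0; \<And>j. j < k \<Longrightarrow> norm (u (Suc j) - u j) \<le> B\<rbrakk> \<Longrightarrow>
      V (x k) (u k) (sample \<tau> w k) \<le> \<beta>x (V (x 0) (u 0) (sample \<tau> w 0)) (real k * \<tau>) + \<gamma>xu \<tau> * B + \<gamma>xd d \<tau>"
  proof (rule plant_estimate_causal[OF plant_est period \<epsilon>xw], goal_cases)
    case 1
    show ?case by (rule 1(1)) (fact 1)+
  qed
  obtain \<epsilon>1 \<epsilon>3 \<beta>z \<beta>u \<gamma>zx \<gamma>zd \<gamma>ud where \<epsilon>13: "0 < \<epsilon>1" "0 < \<epsilon>3"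
    and KLz: "class_KL \<beta>z" "class_KL \<beta>u" "class_KL \<gamma>zx" and Kz: "class_K \<gamma>zd" "class_K \<gamma>ud"
    and algorithm_bound: "\<And>w x y z u d s k. \<lbrakk>disturbance Ws w; closed_loop f g q T \<tau> w x y z u;
      \<And>t. 0 \<le> t \<Longrightarrow> norm (signal_deriv w t) \<le> d; 0 \<le> W (z 0) (sample \<tau> w 0); W (z 0) (sample \<tau> w 0) \<le> \<epsilon>1; d \<le> \<epsilon>3;
      s \<le> \<epsilon>2; \<And>j. j \<le> k \<Longrightarrow> V (x j) (u j) (sample \<tau> w j) \<le> s\<rbrakk> \<Longrightarrow>
      W (z k) (sample \<tau> w k) \<le> \<beta>z (W (z 0) (sample \<tau> w 0)) (real k) + \<gamma>zx s \<tau> + \<gamma>zd d \<and>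
      norm (u (Suc k) - u k) \<le> \<beta>u (W (z 0) (sample \<tau> w 0)) (real k) + \<gamma>ux s \<tau> + \<gamma>ud d"
  proof (rule algorithm_estimate_causal[OF algorithm_est period q_range], goal_cases)
    case 1
    show ?case by (rule V_nonneg) (fact 1)+
  next
    case 2
    show ?case by (rule V_zero) (fact 2)+
  next
    case 3
    show ?case by (rule 3(1)) (fact 3)+
  qed
  have \<epsilon>2: "0 < \<epsilon>2" and KLux: "class_KL \<gamma>ux"
    using algorithm_est by (simp_all add: algorithm_estimate_def)
  have \<gamma>xu: "0 < \<gamma>xu \<tau>"
    using plant_est period by (auto simp: plant_estimate_def intro: class_L_pos)
  have sample_in: "sample \<tau> w k \<in> Ws" if "disturbance Ws w" for w k
    using that period by (simp add: disturbance_def sample_def)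
  have input_in: "u k \<in> Us" if "closed_loop f g q T \<tau> w x y z u" for w x y z u k
    using that q_range by (auto simp: closed_loop_def)
  \<comment> \<open>\<open>d\<close> is any pointwise bound on the derivative instead of its
    supremum, which may drop under a shift. With this choice a shifted trajectory keeps the same
    \<open>d\<close>.\<close>
  define traj where "traj Vs Wl D E d \<longleftrightarrow> (\<exists>w x y z u. disturbance Ws w \<and> closed_loop f g q T \<tau> w x y z u \<and>
      (\<forall>t\<ge>0. norm (signal_deriv w t) \<le> d) \<and> Vs = (\<lambda>k. V (x k) (u k) (sample \<tau> w k)) \<and>
      Wl = (\<lambda>k. W (z k) (sample \<tau> w k)) \<and> D = (\<lambda>k. norm (u (Suc k) - u k)) \<and>
      E = (\<lambda>k. norm (z k - zb (sample \<tau> w k))))" for Vs Wl D E d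
  interpret small_gain_loop traj \<beta>x \<beta>z \<beta>u "\<lambda>s. \<gamma>xd s \<tau>" "\<lambda>s. \<gamma>zx s \<tau>" "\<lambda>s. \<gamma>ux s \<tau>" \<gamma>zd \<gamma>ud \<alpha>1 \<alpha>2
    "\<gamma>xu \<tau>" \<tau> "0.25 * \<epsilon>x" b0 \<epsilon>1 \<epsilon>2 "min d0 \<epsilon>3" \<mu> \<epsilon>z
  proof
    show "class_K (\<lambda>s. \<gamma>xd s \<tau>)" "class_K (\<lambda>s. \<gamma>zx s \<tau>)" "class_K (\<lambda>s. \<gamma>ux s \<tau>)"
      using KLx KLz KLux period by (auto intro: class_KL_class_K)
    show "class_K \<alpha>1" "class_K \<alpha>2" using Kinf by (auto simp: class_K_inf_def)
    show "0 < 0.25 * \<epsilon>x" "0 < min d0 \<epsilon>3" using \<epsilon>xw bd \<epsilon>13 by auto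
    show "\<gamma>xu \<tau> * \<gamma>ux s \<tau> < s" if "0 < s" "s \<le> 0.25 * \<epsilon>x" "s \<le> \<epsilon>2" for s
      using small_gain that by simp
  next
    fix Vs Wl D E :: "nat \<Rightarrow> real" and d :: real
    assume "traj Vs Wl D E d"
    then obtain w x y z u where w: "disturbance Ws w" and loop: "closed_loop f g q T \<tau> w x y z u"
      and d: "\<forall>t\<ge>0. norm (signal_deriv w t) \<le> d"
      and eqs: "Vs = (\<lambda>k. V (x k) (u k) (sample \<tau> w k))" "Wl = (\<lambda>k. W (z k) (sample \<tau> w k))"
        "D = (\<lambda>k. norm (u (Suc k) - u k))" "E = (\<lambda>k. norm (z k - zb (sample \<tau> w k)))"
      unfolding traj_def by blast
    note ws = sample_in[OF w] and us = input_in[OF loop]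
    show "0 \<le> Vs k" "0 \<le> D k" "0 \<le> E k" for k
      using V_nonneg[OF us ws] by (simp_all add: eqs)
    show "0 \<le> d" using d norm_ge_zero order_trans by blast
    show "traj (\<lambda>k. Vs (n + k)) (\<lambda>k. Wl (n + k)) (\<lambda>k. D (n + k)) (\<lambda>k. E (n + k)) d" for n
    proof -
      let ?s = "real n * \<tau>"
      let ?w = "\<lambda>t. w (t + ?s)"
      have s: "0 \<le> ?s" using period by simp
      have smp: "sample \<tau> ?w k = sample \<tau> w (n + k)" for k
        by (simp add: sample_def algebra_simps)
      have "closed_loop f g q T \<tau> ?w (\<lambda>k. x (n + k)) (\<lambda>k. y (n + k)) (\<lambda>k. z (n + k)) (\<lambda>k. u (n + k))"
        using loop by (simp add: closed_loop_def plant_step_shift smp)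
      moreover have "\<forall>t\<ge>0. norm (signal_deriv ?w t) \<le> d"
        using d s by (simp add: signal_deriv_shift(2)[OF w s])
      moreover have "disturbance Ws ?w" by (rule disturbance_shift[OF w s])
      ultimately show ?thesis
        unfolding traj_def eqs
        by (intro exI[of _ ?w] exI[of _ "\<lambda>k. x (n + k)"] exI[of _ "\<lambda>k. y (n + k)"]
            exI[of _ "\<lambda>k. z (n + k)"] exI[of _ "\<lambda>k. u (n + k)"]) (simp add: smp)
    qed
    show "Vs k \<le> \<beta>x (Vs 0) (real k * \<tau>) + \<gamma>xu \<tau> * B + \<gamma>xd d \<tau>"
      if "Vs 0 \<le> 0.25 * \<epsilon>x" "d \<le> min d0 \<epsilon>3" "0 \<le> B" "B \<le> b0" "\<forall>j<k. D j \<le> B" for B k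
      using that us loop d unfolding eqs by (intro plant_bound[OF w]) (auto simp: closed_loop_def)
    show "Wl k \<le> \<beta>z (Wl 0) (real k) + \<gamma>zx s \<tau> + \<gamma>zd d \<and> D k \<le> \<beta>u (Wl 0) (real k) + \<gamma>ux s \<tau> + \<gamma>ud d"
      if "0 \<le> Wl 0" "Wl 0 \<le> \<epsilon>1" "d \<le> min d0 \<epsilon>3" "s \<le> \<epsilon>2" "\<forall>j\<le>k. Vs j \<le> s" for s k
      using that d unfolding eqs by (intro algorithm_bound[OF w loop]) auto
    show "E (Suc k) \<le> \<epsilon>z" if "E k \<le> \<mu>" "D k \<le> \<mu>" "Vs (Suc k) \<le> \<mu>" "d \<le> \<mu>" for k
      using near[OF w loop d] that unfolding eqs by blast
    show "\<alpha>1 (E k) \<le> Wl k \<and> Wl k \<le> \<alpha>2 (E k)" if "E k \<le> \<epsilon>z" for k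
      using W zb ws that unfolding eqs by blast
  qed (fact KLx KLz Kz \<gamma>xu period bd \<epsilon>13 \<epsilon>2 \<mu> \<epsilon>z)+
  \<comment> \<open>Here \<open>d\<close> is the supremum itself;
    \<open>norm_signal_deriv_le\<close> makes it an admissible pointwise bound for
    \<open>traj\<close>.\<close>
  define R where "R r d k v \<longleftrightarrow> (\<exists>w x y z u \<delta>x e.
      disturbance Ws w \<and> closed_loop f g q T \<tau> w x y z u \<and>
      (\<forall>k. \<delta>x k = x k - p (u k) (sample \<tau> w k)) \<and> (\<forall>k. e k = z k - zb (sample \<tau> w k)) \<and>
      r = norm (\<delta>x 0, e 0) \<and> d = seq_norm (dist_seq \<tau> w) \<and> v = norm (\<delta>x k, e k))" for r d k v
  have R: "\<exists>Vs Wl D E. traj Vs Wl D E d \<and> Vs 0 \<le> \<alpha>4 * r\<^sup>2 \<and> E 0 \<le> r \<and>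
      v \<le> sqrt (Vs k / \<alpha>3) + E k" and R_nonneg: "0 \<le> r \<and> 0 \<le> d" if R: "R r d k v" for r d k v
  proof -
    from R obtain w x y z u \<delta>x e where w: "disturbance Ws w" and loop: "closed_loop f g q T \<tau> w x y z u"
      and \<delta>x: "\<And>k. \<delta>x k = x k - p (u k) (sample \<tau> w k)" and e: "\<And>k. e k = z k - zb (sample \<tau> w k)"
      and r: "r = norm (\<delta>x 0, e 0)" and d: "d = seq_norm (dist_seq \<tau> w)" and v: "v = norm (\<delta>x k, e k)"
      unfolding R_def by blast
    note ws = sample_in[OF w] and us = input_in[OF loop]
    have deriv: "\<forall>t\<ge>0. norm (signal_deriv w t) \<le> d"
      unfolding d using norm_signal_deriv_le[OF w period] by blast
    then have "0 \<le> d" using norm_ge_zero order_trans by blast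
    then show "0 \<le> r \<and> 0 \<le> d" by (simp add: r)
    let ?V = "\<lambda>k. V (x k) (u k) (sample \<tau> w k)"
    have "traj ?V (\<lambda>k. W (z k) (sample \<tau> w k)) (\<lambda>k. norm (u (Suc k) - u k)) (\<lambda>k. norm (e k)) d"
      unfolding traj_def e using w loop deriv by blast
    moreover have "?V 0 \<le> \<alpha>4 * r\<^sup>2"
    proof -
      have "(norm (\<delta>x 0))\<^sup>2 \<le> r\<^sup>2"
        unfolding r using norm_fst_le[of "\<delta>x 0" "e 0"] by (intro power_mono) simp_all
      then have "\<alpha>4 * (norm (\<delta>x 0))\<^sup>2 \<le> \<alpha>4 * r\<^sup>2" using \<alpha>(2) by simp
      then show ?thesis using upper[OF us ws, of "x 0" 0 0] by (simp add: \<delta>x)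
    qed
    moreover have "norm (e 0) \<le> r"
      unfolding r using norm_snd_le[of "e 0" "\<delta>x 0"] by simp
    moreover have "v \<le> sqrt (?V k / \<alpha>3) + norm (e k)"
    proof -
      have "norm (\<delta>x k) \<le> sqrt (?V k / \<alpha>3)"
        using lower[OF us ws, of "x k" k k] \<alpha>(1) by (intro real_le_rsqrt) (simp add: \<delta>x field_simps)
      then show ?thesis unfolding v using norm_Pair_le[of "\<delta>x k" "e k"] by linarith
    qed
    ultimately show "\<exists>Vs Wl D E. traj Vs Wl D E d \<and> Vs 0 \<le> \<alpha>4 * r\<^sup>2 \<and> E 0 \<le> r \<and> v \<le> sqrt (Vs k / \<alpha>3) + E k"
      by blast
  qed
  \<comment> \<open>An initial error of norm at most \<open>\<rho> \<delta>\<close> makes both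
    initial quantities at most \<delta>: \<open>V\<close> through its quadratic upper bound,
    \<open>E\<close> directly.\<close>
  define \<rho> where "\<rho> \<delta> = min \<delta> (sqrt (\<delta> / \<alpha>4))" for \<delta>
  have \<rho>: "0 < \<rho> \<delta>" "\<rho> \<delta> \<le> \<delta>" "0 \<le> r \<Longrightarrow> r \<le> \<rho> \<delta> \<Longrightarrow> \<alpha>4 * r\<^sup>2 \<le> \<delta>" if "0 < \<delta>" for \<delta> r
  proof -
    show "0 < \<rho> \<delta>" "\<rho> \<delta> \<le> \<delta>" using that \<alpha>(2) by (auto simp: \<rho>_def)
    assume "0 \<le> r" "r \<le> \<rho> \<delta>"
    then have "r\<^sup>2 \<le> (sqrt (\<delta> / \<alpha>4))\<^sup>2" by (intro power_mono) (auto simp: \<rho>_def)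
    then show "\<alpha>4 * r\<^sup>2 \<le> \<delta>" using that \<alpha>(2) by (simp add: field_simps)
  qed
  \<comment> \<open>Inverts the quadratic lower bound on \<open>V\<close>: half of \<eta> is
    reserved for \<delta>x, the other half for \<open>e\<close>.\<close>
  define \<theta> where "\<theta> \<eta> = min (\<eta> / 2) (\<alpha>3 * (\<eta> / 2)\<^sup>2)" for \<eta>
  have \<theta>: "0 < \<theta> \<eta>" "a \<le> \<theta> \<eta> \<Longrightarrow> b \<le> \<theta> \<eta> \<Longrightarrow> sqrt (a / \<alpha>3) + b \<le> \<eta>" if "0 < \<eta>" for \<eta> a b
  proof -
    show "0 < \<theta> \<eta>" using that \<alpha>(1) by (simp add: \<theta>_def)
    assume ab: "a \<le> \<theta> \<eta>" "b \<le> \<theta> \<eta>"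
    then have "a / \<alpha>3 \<le> (\<eta> / 2)\<^sup>2" using \<alpha>(1) by (simp add: \<theta>_def field_simps)
    then have "sqrt (a / \<alpha>3) \<le> \<eta> / 2" using that by (intro real_le_lsqrt) auto
    then show "sqrt (a / \<alpha>3) + b \<le> \<eta>" using ab(2) by (simp add: \<theta>_def)
  qed
  have S: "\<exists>\<delta>>0. \<forall>r d k v. R r d k v \<and> r \<le> \<delta> \<and> d \<le> \<delta> \<longrightarrow> v \<le> \<eta>" if \<eta>: "0 < \<eta>" for \<eta>
  proof -
    obtain \<delta> where \<delta>: "0 < \<delta>" and stab: "\<And>Vs Wl D E d k. traj Vs Wl D E d \<Longrightarrow> Vs 0 \<le> \<delta> \<Longrightarrow> E 0 \<le> \<delta> \<Longrightarrow> d \<le> \<delta> \<Longrightarrow>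
        Vs k \<le> \<theta> \<eta> \<and> E k \<le> \<theta> \<eta>"
      using stable[OF \<theta>(1)[OF \<eta>]] by blast
    have "v \<le> \<eta>" if r: "R r d k v" "r \<le> \<rho> \<delta>" "d \<le> \<rho> \<delta>" for r d k v
    proof -
      obtain Vs Wl D E where t: "traj Vs Wl D E d" "Vs 0 \<le> \<alpha>4 * r\<^sup>2" "E 0 \<le> r" "v \<le> sqrt (Vs k / \<alpha>3) + E k"
        using R[OF r(1)] by blast
      have "Vs k \<le> \<theta> \<eta> \<and> E k \<le> \<theta> \<eta>"
        using t(2,3) r \<rho>(2)[OF \<delta>] \<rho>(3)[OF \<delta>, of r] R_nonneg[OF r(1)] by (intro stab[OF t(1)]) linarith+
      then show ?thesis using \<theta>(2)[OF \<eta>, of "Vs k" "E k"] t(4) by linarith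
    qed
    with \<rho>(1)[OF \<delta>] show ?thesis by blast
  qed
  obtain \<epsilon> where \<epsilon>: "0 < \<epsilon>" and attr: "\<forall>\<eta>>0. \<exists>\<delta>>0. \<exists>N. \<forall>Vs Wl D E d. traj Vs Wl D E d \<and> Vs 0 \<le> \<epsilon> \<and> E 0 \<le> \<epsilon> \<and> d \<le> \<delta> \<longrightarrow>
      (\<forall>k\<ge>N. Vs k \<le> \<eta> \<and> E k \<le> \<eta>)"
    using attractive by blast
  have A: "\<exists>\<delta>>0. \<exists>N. \<forall>r d k v. R r d k v \<and> r \<le> \<rho> \<epsilon> \<and> d \<le> \<delta> \<and> N \<le> k \<longrightarrow> v \<le> \<eta>" if \<eta>: "0 < \<eta>" for \<eta>
  proof -
    obtain \<delta> N where \<delta>: "0 < \<delta>" and att: "\<And>Vs Wl D E d k. traj Vs Wl D E d \<Longrightarrow> Vs 0 \<le> \<epsilon> \<Longrightarrow> E 0 \<le> \<epsilon> \<Longrightarrow> d \<le> \<delta> \<Longrightarrow>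
        N \<le> k \<Longrightarrow> Vs k \<le> \<theta> \<eta> \<and> E k \<le> \<theta> \<eta>"
      using attr[rule_format, OF \<theta>(1)[OF \<eta>]] by blast
    have "v \<le> \<eta>" if r: "R r d k v" "r \<le> \<rho> \<epsilon>" "d \<le> \<delta>" "N \<le> k" for r d k v
    proof -
      obtain Vs Wl D E where t: "traj Vs Wl D E d" "Vs 0 \<le> \<alpha>4 * r\<^sup>2" "E 0 \<le> r" "v \<le> sqrt (Vs k / \<alpha>3) + E k"
        using R[OF r(1)] by blast
      have "Vs k \<le> \<theta> \<eta> \<and> E k \<le> \<theta> \<eta>"
        using t(2,3) r(2) \<rho>(2)[OF \<epsilon>] \<rho>(3)[OF \<epsilon>, of r] R_nonneg[OF r(1)]
        by (intro att[OF t(1) _ _ r(3,4)]) linarith+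
      then show ?thesis using \<theta>(2)[OF \<eta>, of "Vs k" "E k"] t(4) by linarith
    qed
    with \<delta> show ?thesis by blast
  qed
  have "\<exists>\<epsilon>>0. \<exists>\<beta> \<gamma>. class_KL \<beta> \<and> class_K \<gamma> \<and>
      (\<forall>r d k v. R r d k v \<and> r \<le> \<epsilon> \<and> d \<le> \<epsilon> \<longrightarrow> v \<le> \<beta> r (real k) + \<gamma> d)"
    by (rule stable_attractive_imp_LISS[OF R_nonneg S \<rho>(1)[OF \<epsilon>] A])
  then obtain \<epsilon>' \<beta> \<gamma> where "0 < \<epsilon>'" "class_KL \<beta>" "class_K \<gamma>"
    and "\<And>r d k v. R r d k v \<Longrightarrow> r \<le> \<epsilon>' \<Longrightarrow> d \<le> \<epsilon>' \<Longrightarrow> v \<le> \<beta> r (real k) + \<gamma> d"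
    by blast
  moreover have "R (norm (\<delta>x 0, e 0)) (seq_norm (dist_seq \<tau> w)) k (norm (\<delta>x k, e k))"
    if "disturbance Ws w" "closed_loop f g q T \<tau> w x y z u"
      "\<forall>k. \<delta>x k = x k - p (u k) (sample \<tau> w k)" "\<forall>k. e k = z k - zb (sample \<tau> w k)" for w x y z u \<delta>x e k
    unfolding R_def using that by blast
  ultimately show ?thesis by meson
qed

end
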